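(* Let $\beta>0$, $\lambda\in\mathbb R$, and let $\bar q\in\mathcal D_{\beta,\lambda}:=\{\bar q\ge0:\ 1-\lambda+\beta^2\bar q>0\}$. Set $\sigma=(1-\lambda+\beta^2\bar q)^{-1/2}$ and $$\tilde A(\beta,\lambda,\bar q)=\log\sigma+\frac12\beta^2\bar q\sigma^2+\frac{\beta^2}{4}\bar q^2.$$ Then for every $N\ge1$ $$A_N(\beta,\lambda)=\tilde A(\beta,\lambda,\bar q)-\frac{\beta^2}{4}\int_0^1\big\langle (q_{12}-\bar q)^2\big\rangle_t\,dt,$$ and consequently $A_N(\beta,\lambda)\le\tilde A(\beta,\lambda,\bar q)$ uniformly in $N$.
   Context: For $N\ge 1$, $\beta>0$, $\lambda\in\mathbb{R}$, let $J=(J_{ij})_{i,j=1}^N$ be $N^2$ i.i.d. standard Gaussian $\mathcal N(0,1)$ random variables (one for each ordered pair $(i,j)$, diagonal pairs included). $\mathbb E_z$ denotes integration with respect to the standard Gaussian measure $(2\pi)^{-N/2}e^{-\|z\|^2/2}dz$ on $\mathbb R^N$, and $\mathbb E$ denotes expectation with respect to all the Gaussian disorder variables. The (zero-field) partition function is $$Z_N(\beta,\lambda;J)=\mathbb E_z\exp\Big(\frac{\beta}{\sqrt{2N}}\sum_{i,j=1}^N J_{ij}z_iz_j-\frac{\beta^2}{4N}\Big(\sum_{i=1}^N z_i^2\Big)^2+\frac{\lambda}{2}\sum_{i=1}^N z_i^2\Big),$$ and $A_N(\beta,\lambda)=\frac1N\mathbb E\log Z_N(\beta,\lambda;J)$.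 RS interpolation: let $(J'_i)_{i=1}^N$ be i.i.d. $\mathcal N(0,1)$, independent of $J$; fix $\bar q\in\mathcal D_{\beta,\lambda}$ and $c=-\beta^2\bar q$. For $t\in[0,1]$ the interpolating Gibbs weight is $$\exp\Big(\beta\sqrt{\tfrac{t}{2N}}\sum_{i,j=1}^NJ_{ij}z_iz_j-\tfrac{t\beta^2}{4N}\big(\textstyle\sum_i z_i^2\big)^2+\beta\sqrt{1-t}\sqrt{\bar q}\sum_iJ'_iz_i+\tfrac{(1-t)c}{2}\sum_i z_i^2+\tfrac\lambda2\sum_iz_i^2\Big)$$ with respect to the standard Gaussian measure on $\mathbb R^N$; $\omega_t$ is the associated Gibbs probability measure, and for a function $F$ of two replicas $z^{(1)},z^{(2)}$, $\langle F\rangle_t=\mathbb E[(\omega_t\otimes\omega_t)(F)]$, with $\mathbb E$ over $J$ and $J'$. The overlap is $q_{12}=\frac1N\sum_{i=1}^N z^{(1)}_iz^{(2)}_i$. *)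

theory Defs
  imports "HOL-Probability.Probability"
begin

definition stdG :: "real measure" where
  "stdG = density lborel std_normal_density"

definition gaussN :: "nat \<Rightarrow> (nat \<Rightarrow> real) measure" where
  "gaussN N = PiM {..<N} (\<lambda>_. stdG)"

definition disorderN :: "nat \<Rightarrow> (nat \<times> nat \<Rightarrow> real) measure" where
  "disorderN N = PiM ({..<N} \<times> {..<N}) (\<lambda>_. stdG)"

definition sqnorm :: "nat \<Rightarrow> (nat \<Rightarrow> real) \<Rightarrow> real" where
  "sqnorm N z = (\<Sum>i<N. (z i)^2)"

definition quadJ :: "nat \<Rightarrow> (nat \<times> nat \<Rightarrow> real) \<Rightarrow> (nat \<Rightarrow> real) \<Rightarrow> real" where
  "quadJ N J z = (\<Sum>i<N. \<Sum>j<N. J (i,j) * z i * z j)"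

definition HN :: "nat \<Rightarrow> real \<Rightarrow> real \<Rightarrow> (nat \<times> nat \<Rightarrow> real) \<Rightarrow> (nat \<Rightarrow> real) \<Rightarrow> real" where
  "HN N \<beta> lam J z = \<beta> / sqrt (2 * real N) * quadJ N J z
      - \<beta>^2 / (4 * real N) * (sqnorm N z)^2 + lam / 2 * sqnorm N z"

definition ZN :: "nat \<Rightarrow> real \<Rightarrow> real \<Rightarrow> (nat \<times> nat \<Rightarrow> real) \<Rightarrow> real" where
  "ZN N \<beta> lam J = (\<integral>z. exp (HN N \<beta> lam J z) \<partial>gaussN N)"

definition AN :: "nat \<Rightarrow> real \<Rightarrow> real \<Rightarrow> real" where
  "AN N \<beta> lam = (1 / real N) * (\<integral>J. ln (ZN N \<beta> lam J) \<partial>disorderN N)"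

definition Dset :: "real \<Rightarrow> real \<Rightarrow> real set" where
  "Dset \<beta> lam = {q. q \<ge> 0 \<and> 1 - lam + \<beta>^2 * q > 0}"

definition Atilde :: "real \<Rightarrow> real \<Rightarrow> real \<Rightarrow> real" where
  "Atilde \<beta> lam q = (let \<sigma> = 1 / sqrt (1 - lam + \<beta>^2 * q) in
      ln \<sigma> + 1/2 * \<beta>^2 * q * \<sigma>^2 + \<beta>^2 / 4 * q^2)"

definition Hint :: "nat \<Rightarrow> real \<Rightarrow> real \<Rightarrow> real \<Rightarrow> real \<Rightarrow> (nat \<times> nat \<Rightarrow> real)
    \<Rightarrow> (nat \<Rightarrow> real) \<Rightarrow> (nat \<Rightarrow> real) \<Rightarrow> real" where
  "Hint N \<beta> lam q t J J' z = (let c = -(\<beta>^2 * q) in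
      \<beta> * sqrt (t / (2 * real N)) * quadJ N J z
      - t * \<beta>^2 / (4 * real N) * (sqnorm N z)^2
      + \<beta> * sqrt (1 - t) * sqrt q * (\<Sum>i<N. J' i * z i)
      + (1 - t) * c / 2 * sqnorm N z + lam / 2 * sqnorm N z)"

definition Zint :: "nat \<Rightarrow> real \<Rightarrow> real \<Rightarrow> real \<Rightarrow> real \<Rightarrow> (nat \<times> nat \<Rightarrow> real)
    \<Rightarrow> (nat \<Rightarrow> real) \<Rightarrow> real" where
  "Zint N \<beta> lam q t J J' = (\<integral>z. exp (Hint N \<beta> lam q t J J' z) \<partial>gaussN N)"

definition omega2 :: "nat \<Rightarrow> real \<Rightarrow> real \<Rightarrow> real \<Rightarrow> real \<Rightarrow> (nat \<times> nat \<Rightarrow> real)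
    \<Rightarrow> (nat \<Rightarrow> real) \<Rightarrow> ((nat \<Rightarrow> real) \<Rightarrow> (nat \<Rightarrow> real) \<Rightarrow> real) \<Rightarrow> real" where
  "omega2 N \<beta> lam q t J J' F =
     (\<integral>zz. F (fst zz) (snd zz) * exp (Hint N \<beta> lam q t J J' (fst zz))
              * exp (Hint N \<beta> lam q t J J' (snd zz)) \<partial>(gaussN N \<Otimes>\<^sub>M gaussN N))
     / (Zint N \<beta> lam q t J J')^2"

definition bracket :: "nat \<Rightarrow> real \<Rightarrow> real \<Rightarrow> real \<Rightarrow> real
    \<Rightarrow> ((nat \<Rightarrow> real) \<Rightarrow> (nat \<Rightarrow> real) \<Rightarrow> real) \<Rightarrow> real" where
  "bracket N \<beta> lam q t F =
     (\<integral>JJ. omega2 N \<beta> lam q t (fst JJ) (snd JJ) F \<partial>(disorderN N \<Otimes>\<^sub>M gaussN N))"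

definition overlap :: "nat \<Rightarrow> (nat \<Rightarrow> real) \<Rightarrow> (nat \<Rightarrow> real) \<Rightarrow> real" where
  "overlap N z1 z2 = (1 / real N) * (\<Sum>i<N. z1 i * z2 i)"

end

(*
Both parts of the interpolating Hamiltonian have the form
  sum_k sqrt (s_k t) x_k g_k(z) - s_k t g_k(z)^2 / 2
with i.i.d. standard Gaussian x_k and s_k t affine in t: the quartic term and the field c are exactly
the counterterms that normalise the exponentials.  Hence, after Gaussian integration by parts, the
diagonal terms <g_k^2> cancel and
  d/dt E ln Z = - 1/2 sum_k s_k'(t) E <g_k>^2.
Here g ranges over beta z_i z_j / sqrt (2 N) (s = t) and beta sqrt q z_i (s = 1 - t), so the right-hand
side is N beta^2 / 4 (q^2 - <(q_12 - q)^2>).  At t = 0 the Gibbs measure is Gaussian and factorises.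
All dominations rest on one bound: completing the square in sqrt (s_k) x_k g_k costs exp (|x|^2 / (4 kappa))
and only a small part of the counterterm, while Jensen's inequality bounds ln Z from below and turns
exponential integrability of g_k^2 into a bound on <g_k^2> that is quadratic in x.
*)

theory Submission
  imports Defs "HOL-Real_Asymp.Real_Asymp"
begin

section \<open>Integrals depending on a parameter\<close>

text \<open>The derivative in t contains c_k / sqrt s_k, and each family of variances vanishes at
  one endpoint. So two kinds of estimates are needed: bounds uniform on the closed interval, which
  make the free energy continuous up to t = 0 and t = 1, and bounds locally uniform on the open
  interval, where all s_k stay above some delta > 0, which justify differentiating first under the
  Gibbs integral and then under the disorder integral. The parameter \<open>\<kappa>\<close> serves
  both: the weight stays integrable when only the fraction 1/2 - 2 \<open>\<kappa>\<close> of each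
  s_k g_k^2 is subtracted. One \<open>\<kappa>\<close> pays for the linear disorder term, the other
  for an exponential moment of sum g_k^2. Such slack exists for the spin glass because the exponent
  is affine in t, so only the endpoints matter: at t = 1 the quartic term beats any lam, and at t =
  0 the strict inequality 1 - lam + beta^2 q > 0 leaves room.\<close>

lemma DERIV_lebesgue_integral:
  fixes f f' :: "real \<Rightarrow> 'a \<Rightarrow> real"
  assumes x0: "a < x0" "x0 < b"
    and int: "\<And>x. a < x \<Longrightarrow> x < b \<Longrightarrow> integrable M (f x)"
    and der: "\<And>x z. a < x \<Longrightarrow> x < b \<Longrightarrow> z \<in> space M \<Longrightarrow> ((\<lambda>x. f x z) has_real_derivative f' x z) (at x)"
    and bd: "\<And>x z. a < x \<Longrightarrow> x < b \<Longrightarrow> z \<in> space M \<Longrightarrow> \<bar>f' x z\<bar> \<le> B z"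
    and B: "integrable M B"
    and meas: "f' x0 \<in> borel_measurable M"
  shows "((\<lambda>x. \<integral>z. f x z \<partial>M) has_real_derivative (\<integral>z. f' x0 z \<partial>M)) (at x0)"
proof -
  have "((\<lambda>y. ((\<integral>z. f y z \<partial>M) - (\<integral>z. f x0 z \<partial>M)) / (y - x0)) \<longlongrightarrow> (\<integral>z. f' x0 z \<partial>M)) (at x0)"
    unfolding tendsto_at_iff_sequentially
  proof (intro allI impI, unfold comp_def)
    fix X :: "nat \<Rightarrow> real"
    assume X: "\<forall>i. X i \<in> UNIV - {x0}" "X \<longlonglongrightarrow> x0"
    have "eventually (\<lambda>n. X n \<in> {a<..<b}) sequentially"
      using X(2) x0 by (intro topological_tendstoD) auto
    then obtain N where N: "\<And>n. n \<ge> N \<Longrightarrow> a < X n \<and> X n < b"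
      by (auto simp: eventually_sequentially)
    \<comment> \<open>Dropping finitely many terms puts the whole sequence inside (a, b), so the
      domination holds for every index; \<open>LIMSEQ_offset\<close> undoes the shift at the
      end.\<close>
    define Y where "Y n = X (n + N)" for n
    have Y: "a < Y n" "Y n < b" "Y n \<noteq> x0" for n
      using N[of "n + N"] X(1) by (auto simp: Y_def)
    have Ylim: "Y \<longlonglongrightarrow> x0"
      unfolding Y_def using X(2) by (rule LIMSEQ_ignore_initial_segment)
    have "(\<lambda>n. \<integral>z. (f (Y n) z - f x0 z) / (Y n - x0) \<partial>M) \<longlonglongrightarrow> (\<integral>z. f' x0 z \<partial>M)"
    proof (rule integral_dominated_convergence[where w=B])
      show "f' x0 \<in> borel_measurable M" "integrable M B" by fact+
      show "(\<lambda>z. (f (Y n) z - f x0 z) / (Y n - x0)) \<in> borel_measurable M" for n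
        using int[OF Y(1,2)] int[OF x0] by (intro borel_measurable_divide borel_measurable_diff) auto
      show "AE z in M. (\<lambda>n. (f (Y n) z - f x0 z) / (Y n - x0)) \<longlonglongrightarrow> f' x0 z"
      proof (rule AE_I2)
        fix z assume "z \<in> space M"
        from der[OF x0 this] have "((\<lambda>y. (f y z - f x0 z) / (y - x0)) \<longlongrightarrow> f' x0 z) (at x0)"
          by (simp add: has_field_derivative_iff)
        then show "(\<lambda>n. (f (Y n) z - f x0 z) / (Y n - x0)) \<longlonglongrightarrow> f' x0 z"
          using Y(3) Ylim unfolding tendsto_at_iff_sequentially by (auto simp: comp_def)
      qed
      show "AE z in M. norm ((f (Y n) z - f x0 z) / (Y n - x0)) \<le> B z" for n
      proof (rule AE_I2)
        fix z assume z: "z \<in> space M"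
        \<comment> \<open>Mean value theorem on either side of x0: the intermediate point stays in
          (a, b), where \<open>B\<close> dominates the derivative, so \<open>B\<close> also
          dominates the difference quotient.\<close>
        have "\<exists>\<xi>. a < \<xi> \<and> \<xi> < b \<and> f (Y n) z - f x0 z = (Y n - x0) * f' \<xi> z"
        proof (cases "Y n < x0")
          case True
          obtain \<xi> where "Y n < \<xi>" "\<xi> < x0" "f x0 z - f (Y n) z = (x0 - Y n) * f' \<xi> z"
            using MVT2[OF True, of "\<lambda>x. f x z" "\<lambda>x. f' x z"] der z x0 Y[of n] by force
          then show ?thesis using x0 Y[of n] by (intro exI[of _ \<xi>]) (auto simp: algebra_simps)
        next
          case False
          then have "x0 < Y n" using Y(3)[of n] by auto
          obtain \<xi> where "x0 < \<xi>" "\<xi> < Y n" "f (Y n) z - f x0 z = (Y n - x0) * f' \<xi> z"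
            using MVT2[OF \<open>x0 < Y n\<close>, of "\<lambda>x. f x z" "\<lambda>x. f' x z"] der z x0 Y[of n] by force
          then show ?thesis using x0 Y[of n] by (intro exI[of _ \<xi>]) auto
        qed
        then show "norm ((f (Y n) z - f x0 z) / (Y n - x0)) \<le> B z"
          using bd z Y(3)[of n] by (auto simp: abs_mult)
      qed
    qed
    moreover have "(\<integral>z. (f (Y n) z - f x0 z) / (Y n - x0) \<partial>M)
        = ((\<integral>z. f (Y n) z \<partial>M) - (\<integral>z. f x0 z \<partial>M)) / (Y n - x0)" for n
      using int[OF Y(1,2)] int[OF x0] by simp
    ultimately have "(\<lambda>n. ((\<integral>z. f (X (n + N)) z \<partial>M) - (\<integral>z. f x0 z \<partial>M)) / (X (n + N) - x0)) \<longlonglongrightarrow> (\<integral>z. f' x0 z \<partial>M)"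
      by (simp only: Y_def)
    then show "(\<lambda>n. ((\<integral>z. f (X n) z \<partial>M) - (\<integral>z. f x0 z \<partial>M)) / (X n - x0)) \<longlonglongrightarrow> (\<integral>z. f' x0 z \<partial>M)"
      by (rule LIMSEQ_offset)
  qed
  then show ?thesis
    by (simp add: has_field_derivative_iff)
qed

lemma continuous_on_lebesgue_integral:
  fixes f :: "real \<Rightarrow> 'a \<Rightarrow> real"
  assumes meas: "\<And>x. x \<in> S \<Longrightarrow> f x \<in> borel_measurable M"
    and cont: "\<And>z. z \<in> space M \<Longrightarrow> continuous_on S (\<lambda>x. f x z)"
    and bd: "\<And>x z. x \<in> S \<Longrightarrow> z \<in> space M \<Longrightarrow> \<bar>f x z\<bar> \<le> B z"
    and B: "integrable M B"
  shows "continuous_on S (\<lambda>x. \<integral>z. f x z \<partial>M)"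
  unfolding continuous_on_sequentially
proof (intro allI ballI impI, unfold comp_def)
  fix X :: "nat \<Rightarrow> real" and x
  assume x: "x \<in> S" and X: "(\<forall>n. X n \<in> S) \<and> X \<longlonglongrightarrow> x"
  show "(\<lambda>n. \<integral>z. f (X n) z \<partial>M) \<longlonglongrightarrow> (\<integral>z. f x z \<partial>M)"
  proof (rule integral_dominated_convergence[where w=B])
    show "AE z in M. (\<lambda>n. f (X n) z) \<longlonglongrightarrow> f x z"
      using cont x X by (intro AE_I2) (auto simp: continuous_on_sequentially comp_def)
    show "AE z in M. norm (f (X n) z) \<le> B z" for n
      using bd X by (intro AE_I2) auto
  qed (use meas x X B in auto)
qed

lemma gibbs_jensen:
  fixes f h :: "'a \<Rightarrow> real"
  assumes f: "integrable M f" "\<And>z. z \<in> space M \<Longrightarrow> 0 \<le> f z" "0 < (\<integral>z. f z \<partial>M)"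
    and h: "integrable M (\<lambda>z. h z * f z)"
    and eh: "integrable M (\<lambda>z. exp (h z) * f z)"
  shows "0 < (\<integral>z. exp (h z) * f z \<partial>M)"
    and "(\<integral>z. h z * f z \<partial>M) / (\<integral>z. f z \<partial>M) \<le> ln ((\<integral>z. exp (h z) * f z \<partial>M) / (\<integral>z. f z \<partial>M))"
proof -
  let ?I = "\<integral>z. f z \<partial>M"
  define m where "m = (\<integral>z. h z * f z \<partial>M) / ?I"
  have "(\<integral>z. (1 - m) * f z + h z * f z \<partial>M) \<le> (\<integral>z. exp (- m) * (exp (h z) * f z) \<partial>M)"
  proof (rule integral_mono)
    fix z assume z: "z \<in> space M"
    have "1 + (h z - m) \<le> exp (h z - m)" by (rule exp_ge_add_one_self)
    from mult_right_mono[OF this f(2)[OF z]]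
    show "(1 - m) * f z + h z * f z \<le> exp (- m) * (exp (h z) * f z)"
      by (simp add: exp_diff exp_minus field_simps)
  qed (use f h eh in auto)
  \<comment> \<open>Since \<open>m\<close> is the mean of \<open>h\<close>, the first-order terms
    cancel and only \<open>?I\<close> is left.\<close>
  also have "(\<integral>z. (1 - m) * f z + h z * f z \<partial>M) = (1 - m) * ?I + m * ?I"
    using f h by (simp add: m_def)
  also have "\<dots> = ?I" by (simp add: left_diff_distrib)
  finally have "?I \<le> exp (- m) * (\<integral>z. exp (h z) * f z \<partial>M)"
    by simp
  then have *: "exp m * ?I \<le> (\<integral>z. exp (h z) * f z \<partial>M)"
    by (simp add: exp_minus field_simps)
  moreover have "0 < exp m * ?I" using f by simp
  ultimately show pos: "0 < (\<integral>z. exp (h z) * f z \<partial>M)" by linarith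
  from * have "exp m \<le> (\<integral>z. exp (h z) * f z \<partial>M) / ?I" using f by (simp add: field_simps)
  then show "(\<integral>z. h z * f z \<partial>M) / ?I \<le> ln ((\<integral>z. exp (h z) * f z \<partial>M) / ?I)"
    unfolding m_def[symmetric] using pos f by (subst ln_ge_iff) auto
qed

lemma power_le_fact_exp:
  fixes u :: real
  assumes "0 \<le> u"
  shows "u ^ n \<le> fact n * exp u"
proof -
  have "u ^ n / fact n \<le> exp u"
  proof -
    have "sum (\<lambda>k. u ^ k / fact k) {n} \<le> (\<Sum>k. u ^ k /\<^sub>R fact k)"
      using assms summable_exp_generic[of u]
      by (intro order_trans[OF _ sum_le_suminf[of _ "{n}"]]) (auto simp: field_simps)
    then show ?thesis by (simp add: exp_def)
  qed
  then show ?thesis by (simp add: field_simps)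
qed

text \<open>A factor |g|^n costs n! and one extra unit of exponential rate, so integrability at all
  rates controls all moments locally uniformly in r. The intended r is sqrt s_k times one disorder
  coordinate: differentiating in that coordinate just raises n.\<close>

lemma DERIV_exponential_moment:
  fixes f g :: "'a \<Rightarrow> real"
  assumes [measurable]: "f \<in> borel_measurable M" "g \<in> borel_measurable M"
    and f: "\<And>z. z \<in> space M \<Longrightarrow> 0 \<le> f z"
    and int: "\<And>c. integrable M (\<lambda>z. exp (c * \<bar>g z\<bar>) * f z)"
  shows "integrable M (\<lambda>z. g z ^ n * (exp (r * g z) * f z))"
    and "((\<lambda>r. \<integral>z. g z ^ n * (exp (r * g z) * f z) \<partial>M) has_real_derivative
           (\<integral>z. g z ^ Suc n * (exp (r * g z) * f z) \<partial>M)) (at r)"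
proof -
  have bd: "\<bar>g z ^ n * (exp (r * g z) * f z)\<bar> \<le> fact n * (exp ((R + 1) * \<bar>g z\<bar>) * f z)"
    if "z \<in> space M" "\<bar>r\<bar> \<le> R" for z n r R
  proof -
    have "\<bar>g z\<bar> ^ n * exp (r * g z) \<le> (fact n * exp \<bar>g z\<bar>) * exp (R * \<bar>g z\<bar>)"
    proof (rule mult_mono)
      have "r * g z \<le> \<bar>r\<bar> * \<bar>g z\<bar>" by (simp add: abs_mult[symmetric])
      also have "\<dots> \<le> R * \<bar>g z\<bar>" using that by (intro mult_right_mono) auto
      finally show "exp (r * g z) \<le> exp (R * \<bar>g z\<bar>)" by simp
    qed (auto intro: power_le_fact_exp)
    then have "\<bar>g z\<bar> ^ n * exp (r * g z) \<le> fact n * exp ((R + 1) * \<bar>g z\<bar>)"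
      by (simp add: exp_add[symmetric] algebra_simps)
    from mult_right_mono[OF this f[OF that(1)]] show ?thesis
      using f[OF that(1)] by (simp add: abs_mult power_abs algebra_simps)
  qed
  show int': "integrable M (\<lambda>z. g z ^ n * (exp (r * g z) * f z))" for n r
    by (rule Bochner_Integration.integrable_bound[of _ "\<lambda>z. fact n * (exp ((\<bar>r\<bar> + 1) * \<bar>g z\<bar>) * f z)"])
      (use int bd f in \<open>auto intro!: AE_I2 simp: abs_mult\<close>)
  show "((\<lambda>r. \<integral>z. g z ^ n * (exp (r * g z) * f z) \<partial>M) has_real_derivative
           (\<integral>z. g z ^ Suc n * (exp (r * g z) * f z) \<partial>M)) (at r)"
  \<comment> \<open>A symmetric interval around 0 containing r, so that \<open>bd\<close> applies
    with R = |r| + 1.\<close>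
  proof (rule DERIV_lebesgue_integral[of "-\<bar>r\<bar>-1" _ "\<bar>r\<bar>+1"])
    show "\<bar>g z ^ Suc n * (exp (x * g z) * f z)\<bar> \<le> fact (Suc n) * (exp ((\<bar>r\<bar> + 1 + 1) * \<bar>g z\<bar>) * f z)"
      if "-\<bar>r\<bar>-1 < x" "x < \<bar>r\<bar>+1" "z \<in> space M" for x z
      using bd[of z x "\<bar>r\<bar>+1" "Suc n"] that by auto
  qed (auto intro!: int' int derivative_eq_intros)
qed

text \<open>With p the standard density, (p f)' = p f' - x p f; integrate over the line, where the
  boundary values of p f vanish. Quadratic growth is assumed because that is the growth available
  for Gibbs averages in one disorder coordinate.\<close>

lemma std_normal_stein:
  fixes f f' :: "real \<Rightarrow> real"
  assumes der: "\<And>x. (f has_real_derivative f' x) (at x)"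
    and cont: "\<And>x. isCont f' x"
    and bf: "\<And>x. \<bar>f x\<bar> \<le> C * (1 + x\<^sup>2)"
    and bf': "\<And>x. \<bar>f' x\<bar> \<le> C * (1 + x\<^sup>2)"
  shows "(\<integral>x. x * f x \<partial>stdG) = (\<integral>x. f' x \<partial>stdG)"
proof -
  let ?p = std_normal_density
  have contf: "isCont f x" for x using der DERIV_isCont by blast
  have mf[measurable]: "f \<in> borel_measurable borel" "f' \<in> borel_measurable borel"
    using contf cont by (auto intro!: borel_measurable_continuous_onI continuous_at_imp_continuous_on)
  have dp: "(?p has_real_derivative - x * ?p x) (at x)" for x
    unfolding std_normal_density_def
    by (auto intro!: derivative_eq_intros simp: field_simps)
  have C: "C \<ge> 0" using bf[of 0] by auto
  have i1: "integrable lborel (\<lambda>x. ?p x * f' x)"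
  proof (rule Bochner_Integration.integrable_bound[of _ "\<lambda>x. C * (?p x * x ^ 0 + ?p x * x ^ 2)"])
    show "integrable lborel (\<lambda>x. C * (?p x * x ^ 0 + ?p x * x ^ 2))"
      using integrable_std_normal_moment by (intro integrable_mult_right Bochner_Integration.integrable_add)
    show "AE x in lborel. norm (?p x * f' x) \<le> norm (C * (?p x * x ^ 0 + ?p x * x ^ 2))"
    proof (rule AE_I2)
      fix x
      have "?p x * \<bar>f' x\<bar> \<le> ?p x * (C * (1 + x\<^sup>2))" using bf' by (intro mult_left_mono) auto
      also have "\<dots> = C * (?p x * x ^ 0 + ?p x * x ^ 2)" by (simp add: algebra_simps)
      also have "\<dots> \<le> \<bar>\<dots>\<bar>" by simp
      finally show "norm (?p x * f' x) \<le> norm (C * (?p x * x ^ 0 + ?p x * x ^ 2))"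
        by (simp add: abs_mult)
    qed
  qed simp
  have i2: "integrable lborel (\<lambda>x. ?p x * (x * f x))"
  proof (rule Bochner_Integration.integrable_bound[of _ "\<lambda>x. C * (?p x * \<bar>x\<bar> ^ 1 + ?p x * \<bar>x\<bar> ^ 3)"])
    show "integrable lborel (\<lambda>x. C * (?p x * \<bar>x\<bar> ^ 1 + ?p x * \<bar>x\<bar> ^ 3))"
      using integrable_std_normal_moment_abs by (intro integrable_mult_right Bochner_Integration.integrable_add)
    show "AE x in lborel. norm (?p x * (x * f x)) \<le> norm (C * (?p x * \<bar>x\<bar> ^ 1 + ?p x * \<bar>x\<bar> ^ 3))"
    proof (rule AE_I2)
      fix x
      have "?p x * (\<bar>x\<bar> * \<bar>f x\<bar>) \<le> ?p x * (\<bar>x\<bar> * (C * (1 + x\<^sup>2)))"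
        using bf by (intro mult_left_mono) auto
      also have "\<dots> = C * (?p x * \<bar>x\<bar> ^ 1 + ?p x * \<bar>x\<bar> ^ 3)"
        by (simp add: algebra_simps power3_eq_cube power2_eq_square)
      also have "\<dots> \<le> \<bar>\<dots>\<bar>" by simp
      finally show "norm (?p x * (x * f x)) \<le> norm (C * (?p x * \<bar>x\<bar> ^ 1 + ?p x * \<bar>x\<bar> ^ 3))"
        by (simp add: abs_mult)
    qed
  qed simp
  have bnd: "norm (?p x * f x) \<le> C * (1 + x\<^sup>2) * exp (- x\<^sup>2 / 2)" for x
  proof -
    have "?p x \<le> exp (- x\<^sup>2 / 2)"
      using pi_ge_two by (auto simp: std_normal_density_def field_simps intro: order_trans[of _ 1])
    then have "?p x * \<bar>f x\<bar> \<le> exp (- x\<^sup>2 / 2) * (C * (1 + x\<^sup>2))" using bf by (intro mult_mono) auto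
    then show ?thesis by (simp add: abs_mult mult.commute)
  qed
  have top: "((\<lambda>x. ?p x * f x) \<longlongrightarrow> 0) at_top"
  proof (rule Lim_null_comparison[OF always_eventually])
    show "((\<lambda>x::real. C * (1 + x\<^sup>2) * exp (- x\<^sup>2 / 2)) \<longlongrightarrow> 0) at_top" by real_asymp
  qed (use bnd in auto)
  have bot: "((\<lambda>x. ?p x * f x) \<longlongrightarrow> 0) at_bot"
  proof (rule Lim_null_comparison[OF always_eventually])
    show "((\<lambda>x::real. C * (1 + x\<^sup>2) * exp (- x\<^sup>2 / 2)) \<longlongrightarrow> 0) at_bot" by real_asymp
  qed (use bnd in auto)
  have "(LBINT x=-\<infinity>..\<infinity>. ?p x * f' x - ?p x * (x * f x)) = 0 - 0"
  proof (rule interval_integral_FTC_integrable[where F="\<lambda>x. ?p x * f x"])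
    show "((\<lambda>x. ?p x * f x) has_vector_derivative ?p x * f' x - ?p x * (x * f x)) (at x)" for x
      unfolding has_real_derivative_iff_has_vector_derivative[symmetric]
      by (auto intro!: derivative_eq_intros der dp simp: algebra_simps)
    show "isCont (\<lambda>x. ?p x * f' x - ?p x * (x * f x)) x" for x
      using DERIV_isCont[OF dp] by (intro continuous_intros cont contf)
    show "set_integrable lborel (einterval (-\<infinity>) \<infinity>) (\<lambda>x. ?p x * f' x - ?p x * (x * f x))"
      using i1 i2 by (simp add: set_integrable_def)
    show "(((\<lambda>x. ?p x * f x) \<circ> real_of_ereal) \<longlongrightarrow> 0) (at_right (-\<infinity>))"
      using bot by (simp add: ereal_tendsto_simps)
    show "(((\<lambda>x. ?p x * f x) \<circ> real_of_ereal) \<longlongrightarrow> 0) (at_left \<infinity>)"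
      using top by (simp add: ereal_tendsto_simps)
  qed simp
  then have "(\<integral>x. ?p x * f' x - ?p x * (x * f x) \<partial>lborel) = 0"
    by (simp add: interval_lebesgue_integral_def set_lebesgue_integral_def)
  then have "(\<integral>x. ?p x * f' x \<partial>lborel) = (\<integral>x. ?p x * (x * f x) \<partial>lborel)"
    using i1 i2 by simp
  then show ?thesis
    unfolding stdG_def by (subst (1 2) integral_density) auto
qed

section \<open>Wick-ordered Gaussian interpolation\<close>

lemma prob_space_stdG: "prob_space stdG"
  unfolding stdG_def by (rule prob_space_normal_density) simp

lemma sets_stdG[measurable_cong, simp]: "sets stdG = sets borel"
  by (simp add: stdG_def)

lemma space_stdG[simp]: "space stdG = UNIV"
  by (simp add: stdG_def)

interpretation stdG: prob_space stdG
  by (rule prob_space_stdG)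

lemma integrable_stdG_square: "integrable stdG (\<lambda>x. x\<^sup>2)"
  unfolding stdG_def using integrable_std_normal_moment[of 2] by (subst integrable_density) auto

lemma integral_stdG_square: "(\<integral>x. x\<^sup>2 \<partial>stdG) = 1"
  unfolding stdG_def using integral_std_normal_moment_even[of 1]
  by (subst integral_density) (auto simp: fact_2 numeral_2_eq_2)

lemma
  fixes f :: "real \<Rightarrow> real"
  assumes [measurable]: "f \<in> borel_measurable borel" and k: "k \<in> K"
  shows integrable_PiM_stdG_component:
      "integrable stdG f \<Longrightarrow> integrable (PiM K (\<lambda>_. stdG)) (\<lambda>x. f (x k))"
    and integral_PiM_stdG_component:
      "(\<integral>x. f (x k) \<partial>PiM K (\<lambda>_. stdG)) = (\<integral>x. f x \<partial>stdG)"
proof -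
  have d: "distr (PiM K (\<lambda>_. stdG)) stdG (\<lambda>x. x k) = stdG"
    using k by (rule distr_PiM_component[OF prob_space_stdG])
  have m[measurable]: "(\<lambda>x. x k) \<in> measurable (PiM K (\<lambda>_. stdG)) stdG"
    using k by (rule measurable_component_singleton)
  show "integrable stdG f \<Longrightarrow> integrable (PiM K (\<lambda>_. stdG)) (\<lambda>x. f (x k))"
    using integrable_distr[OF m, of f] d by simp
  show "(\<integral>x. f (x k) \<partial>PiM K (\<lambda>_. stdG)) = (\<integral>x. f x \<partial>stdG)"
    using integral_distr[OF m, of f] d by simp
qed

text \<open>\<open>a k + c k * t\<close> is the variance carried by coordinate k and
  \<open>w\<close> the part of the energy independent of t and of the disorder. By
  \<open>s_ge\<close> variances can vanish only at the endpoints, with an explicit lower bound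
  inside. \<open>dominated\<close> includes the endpoints and gives up 2 \<open>\<kappa>\<close> of
  the coefficient 1/2 of the counterterm.\<close>

locale wick_interpolation = prob_space M for M :: "'z measure" +
  fixes K :: "'k set" and g :: "'k \<Rightarrow> 'z \<Rightarrow> real" and w D :: "'z \<Rightarrow> real"
    and a c :: "'k \<Rightarrow> real" and \<kappa> :: real
  assumes finK[simp]: "finite K"
    and g_meas[measurable]: "\<And>k. k \<in> K \<Longrightarrow> g k \<in> borel_measurable M"
    and g_sq: "\<And>k. k \<in> K \<Longrightarrow> integrable M (\<lambda>z. (g k z)\<^sup>2)"
    and w_int: "integrable M w"
    and D_int: "integrable M D"
    and kappa: "0 < \<kappa>"
    and s_le1: "\<And>k t. k \<in> K \<Longrightarrow> 0 \<le> t \<Longrightarrow> t \<le> 1 \<Longrightarrow> a k + c k * t \<le> 1"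
    and s_ge: "\<And>k t. k \<in> K \<Longrightarrow> 0 \<le> t \<Longrightarrow> t \<le> 1 \<Longrightarrow> min t (1 - t) \<le> a k + c k * t"
    and dominated: "\<And>t z. 0 \<le> t \<Longrightarrow> t \<le> 1 \<Longrightarrow> z \<in> space M \<Longrightarrow>
       exp (w z - (1/2 - 2 * \<kappa>) * (\<Sum>k\<in>K. (a k + c k * t) * (g k z)\<^sup>2)) \<le> D z"
begin

lemma w_meas[measurable]: "w \<in> borel_measurable M"
  using w_int by auto

definition s :: "'k \<Rightarrow> real \<Rightarrow> real" where
  "s k t = a k + c k * t"

definition H :: "real \<Rightarrow> ('k \<Rightarrow> real) \<Rightarrow> 'z \<Rightarrow> real" where
  "H t x z = (\<Sum>k\<in>K. sqrt (s k t) * x k * g k z - s k t * (g k z)\<^sup>2 / 2) + w z"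

text \<open>Formal t-derivative of \<open>H\<close>. Where a variance vanishes the quotient is 0 by
  convention, so it is used as a derivative only for 0 < t < 1.\<close>

definition H' :: "real \<Rightarrow> ('k \<Rightarrow> real) \<Rightarrow> 'z \<Rightarrow> real" where
  "H' t x z = (\<Sum>k\<in>K. c k / (2 * sqrt (s k t)) * x k * g k z - c k / 2 * (g k z)\<^sup>2)"

definition gsum :: "'z \<Rightarrow> real" where
  "gsum z = (\<Sum>k\<in>K. (g k z)\<^sup>2)"

definition xsum :: "('k \<Rightarrow> real) \<Rightarrow> real" where
  "xsum x = (\<Sum>k\<in>K. (x k)\<^sup>2)"

definition Z :: "real \<Rightarrow> ('k \<Rightarrow> real) \<Rightarrow> real" where
  "Z t x = (\<integral>z. exp (H t x z) \<partial>M)"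

definition avg :: "real \<Rightarrow> ('k \<Rightarrow> real) \<Rightarrow> ('z \<Rightarrow> real) \<Rightarrow> real" where
  "avg t x f = (\<integral>z. f z * exp (H t x z) \<partial>M) / Z t x"

definition P :: "('k \<Rightarrow> real) measure" where
  "P = PiM K (\<lambda>_. stdG)"

definition \<phi> :: "real \<Rightarrow> real" where
  "\<phi> t = (\<integral>x. ln (Z t x) \<partial>P)"

text \<open>The moments of g and the integral of w serve the lower bound on ln Z, 1 / (4
  \<open>\<kappa>\<close>) and ln of the integral of D the upper one; adding them lets a single
  constant serve both.\<close>

definition C0 :: real where
  "C0 = (\<Sum>k\<in>K. (\<integral>z. \<bar>g k z\<bar> \<partial>M) + (\<integral>z. (g k z)\<^sup>2 \<partial>M)) + \<bar>\<integral>z. w z \<partial>M\<bar> + 1 / (4 * \<kappa>) + \<bar>ln (\<integral>z. D z \<partial>M)\<bar>"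

lemma sets_P[measurable_cong]: "sets P = sets (PiM K (\<lambda>_. borel))"
  unfolding P_def by (intro sets_PiM_cong) auto

lemma prob_space_P: "prob_space P"
  unfolding P_def by (intro prob_space_PiM prob_space_stdG)

lemma s_nonneg: "k \<in> K \<Longrightarrow> 0 \<le> t \<Longrightarrow> t \<le> 1 \<Longrightarrow> 0 \<le> s k t"
  using s_ge[of k t] by (auto simp: s_def min_def split: if_splits)

lemma s_le_one: "k \<in> K \<Longrightarrow> 0 \<le> t \<Longrightarrow> t \<le> 1 \<Longrightarrow> s k t \<le> 1"
  using s_le1[of k t] by (auto simp: s_def)

lemma abs_c_le_one: "k \<in> K \<Longrightarrow> \<bar>c k\<bar> \<le> 1"
  using s_le_one[of k 0] s_le_one[of k 1] s_nonneg[of k 0] s_nonneg[of k 1] by (auto simp: s_def)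

lemma gsum_nonneg: "0 \<le> gsum z" and gsum_ge: "k \<in> K \<Longrightarrow> (g k z)\<^sup>2 \<le> gsum z"
  unfolding gsum_def by (auto intro!: sum_nonneg member_le_sum)

lemma xsum_nonneg: "0 \<le> xsum z" and xsum_ge: "k \<in> K \<Longrightarrow> (x k)\<^sup>2 \<le> xsum x"
  unfolding xsum_def by (auto intro!: sum_nonneg member_le_sum)

lemma H_meas[measurable]: "H t x \<in> borel_measurable M"
  unfolding H_def[abs_def] by measurable

lemma gsum_meas[measurable]: "gsum \<in> borel_measurable M"
  unfolding gsum_def[abs_def] by measurable

lemma xsum_meas[measurable]: "xsum \<in> borel_measurable P"
  unfolding xsum_def[abs_def] by measurable

section \<open>Quadratic growth of the log partition function in the disorder\<close>

lemma integrable_g: "k \<in> K \<Longrightarrow> integrable M (g k)"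
proof (rule Bochner_Integration.integrable_bound[of _ "\<lambda>z. 1 + (g k z)\<^sup>2"])
  assume k: "k \<in> K"
  show "integrable M (\<lambda>z. 1 + (g k z)\<^sup>2)" using g_sq[OF k] by auto
  show "AE z in M. norm (g k z) \<le> norm (1 + (g k z)\<^sup>2)"
  proof (rule AE_I2)
    fix z
    have "0 \<le> (\<bar>g k z\<bar> - 1)\<^sup>2" by simp
    then show "norm (g k z) \<le> norm (1 + (g k z)\<^sup>2)" by (simp add: power2_diff)
  qed
qed simp

lemma integrable_H: "integrable M (H t x)"
  unfolding H_def[abs_def]
  by (intro Bochner_Integration.integrable_add Bochner_Integration.integrable_sum
       Bochner_Integration.integrable_diff w_int integrable_mult_right integrable_divide g_sq integrable_g)

text \<open>Young's inequality sqrt s x g <= x^2 / (4 \<open>\<kappa>\<close>) +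
  \<open>\<kappa>\<close> s g^2 spends one \<open>\<kappa>\<close> of the slack; the other, through
  \<open>\<delta>\<close> <= s, pays for the weight exp
  (\<open>\<kappa> * \<delta> * gsum z\<close>). The case \<open>\<delta>\<close> = 0 is the bound
  valid on the closed interval, \<open>\<delta>\<close> > 0 the one for interior t.\<close>

lemma H_bound:
  assumes t: "0 \<le> t" "t \<le> 1" and \<delta>: "\<And>k. k \<in> K \<Longrightarrow> \<delta> \<le> s k t" and z: "z \<in> space M"
  shows "exp (\<kappa> * \<delta> * gsum z) * exp (H t x z) \<le> exp (xsum x / (4 * \<kappa>)) * D z"
proof -
  have "sqrt (s k t) * x k * g k z - s k t * (g k z)\<^sup>2 / 2 + \<kappa> * \<delta> * (g k z)\<^sup>2
     \<le> (x k)\<^sup>2 / (4 * \<kappa>) - (1/2 - 2 * \<kappa>) * (s k t * (g k z)\<^sup>2)" if k: "k \<in> K" for k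
  proof -
    have "0 \<le> (x k - 2 * \<kappa> * (sqrt (s k t) * g k z))\<^sup>2" by simp
    also have "\<dots> = (x k)\<^sup>2 - 4 * \<kappa> * (sqrt (s k t) * x k * g k z) + 4 * \<kappa>\<^sup>2 * (s k t * (g k z)\<^sup>2)"
      using s_nonneg[OF k t] by (simp add: power2_diff power_mult_distrib)
    finally have "sqrt (s k t) * x k * g k z \<le> (x k)\<^sup>2 / (4 * \<kappa>) + \<kappa> * (s k t * (g k z)\<^sup>2)"
      using kappa by (simp add: field_simps power2_eq_square)
    moreover have "\<kappa> * (\<delta> * (g k z)\<^sup>2) \<le> \<kappa> * (s k t * (g k z)\<^sup>2)"
      using kappa \<delta>[OF k] by (intro mult_left_mono mult_right_mono) auto
    ultimately show ?thesis by (simp add: algebra_simps)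
  qed
  then have "(\<Sum>k\<in>K. sqrt (s k t) * x k * g k z - s k t * (g k z)\<^sup>2 / 2 + \<kappa> * \<delta> * (g k z)\<^sup>2)
      \<le> (\<Sum>k\<in>K. (x k)\<^sup>2 / (4 * \<kappa>) - (1/2 - 2 * \<kappa>) * (s k t * (g k z)\<^sup>2))"
    by (rule sum_mono)
  then have "H t x z + \<kappa> * \<delta> * gsum z \<le> xsum x / (4 * \<kappa>) + (w z - (1/2 - 2 * \<kappa>) * (\<Sum>k\<in>K. s k t * (g k z)\<^sup>2))"
    by (simp add: H_def gsum_def xsum_def sum.distrib sum_subtractf sum_distrib_left[symmetric] sum_divide_distrib[symmetric])
  then have "exp (H t x z + \<kappa> * \<delta> * gsum z) \<le> exp (xsum x / (4 * \<kappa>)) * exp (w z - (1/2 - 2 * \<kappa>) * (\<Sum>k\<in>K. s k t * (g k z)\<^sup>2))"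
    by (simp add: exp_add[symmetric])
  also have "\<dots> \<le> exp (xsum x / (4 * \<kappa>)) * D z"
    using dominated[OF t z] by (intro mult_left_mono) (auto simp: s_def)
  finally show ?thesis by (simp add: exp_add mult.commute)
qed

lemma exp_H_bound:
  assumes "0 \<le> t" "t \<le> 1" "z \<in> space M"
  shows "exp (H t x z) \<le> exp (xsum x / (4 * \<kappa>)) * D z"
  using H_bound[of t 0 z x] assms s_nonneg by auto

lemma D_nonneg: "z \<in> space M \<Longrightarrow> 0 \<le> D z"
  using order_trans[OF exp_ge_zero dominated[of 0 z]] by simp

lemma integrable_exp_gsum:
  assumes "0 \<le> t" "t \<le> 1" "\<And>k. k \<in> K \<Longrightarrow> \<delta> \<le> s k t"
  shows "integrable M (\<lambda>z. exp (\<kappa> * \<delta> * gsum z) * exp (H t x z))"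
  by (rule Bochner_Integration.integrable_bound[of _ "\<lambda>z. exp (xsum x / (4 * \<kappa>)) * D z"])
    (use D_int H_bound assms D_nonneg in \<open>auto intro!: AE_I2 simp: abs_mult\<close>)

lemma integrable_exp_H:
  assumes "0 \<le> t" "t \<le> 1"
  shows "integrable M (\<lambda>z. exp (H t x z))"
  using integrable_exp_gsum[of t 0 x] assms s_nonneg by simp

lemma Z_lower:
  assumes t: "0 \<le> t" "t \<le> 1"
  shows "0 < Z t x" "(\<integral>z. H t x z \<partial>M) \<le> ln (Z t x)"
  using gibbs_jensen[of M "\<lambda>_. 1" "H t x"] integrable_H integrable_exp_H[OF t] 
  by (auto simp: Z_def prob_space)

lemma Z_upper:
  assumes t: "0 \<le> t" "t \<le> 1" and \<delta>: "\<And>k. k \<in> K \<Longrightarrow> \<delta> \<le> s k t"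
  shows "(\<integral>z. exp (\<kappa> * \<delta> * gsum z) * exp (H t x z) \<partial>M) \<le> exp (xsum x / (4 * \<kappa>)) * (\<integral>z. D z \<partial>M)"
proof -
  have "(\<integral>z. exp (\<kappa> * \<delta> * gsum z) * exp (H t x z) \<partial>M) \<le> (\<integral>z. exp (xsum x / (4 * \<kappa>)) * D z \<partial>M)"
    by (rule integral_mono) (use integrable_exp_gsum[OF t \<delta>] D_int H_bound[OF t \<delta>] in auto)
  then show ?thesis by simp
qed

text \<open>\<open>D\<close> dominates a partition function, which Jensen shows to be positive; this
  is needed to split the logarithm in \<open>ln_Z_upper\<close>.\<close>

lemma D_pos: "0 < (\<integral>z. D z \<partial>M)"
proof -
  have "0 < Z 0 (\<lambda>_. 0)" by (rule Z_lower) auto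
  also have "\<dots> \<le> exp (xsum (\<lambda>_. 0) / (4 * \<kappa>)) * (\<integral>z. D z \<partial>M)"
    using Z_upper[of 0 0 "\<lambda>_. 0"] s_nonneg by (simp add: Z_def)
  finally show ?thesis by (simp add: zero_less_mult_iff)
qed

text \<open>Stated with the extra weight so that it covers two cases: \<open>\<delta>\<close> = 0
  bounds ln Z, and \<open>\<delta>\<close> > 0 bounds the exponential moment behind
  \<open>avg_g_square_le\<close>.\<close>

lemma ln_Z_upper:
  assumes t: "0 \<le> t" "t \<le> 1" and \<delta>: "\<And>k. k \<in> K \<Longrightarrow> \<delta> \<le> s k t"
    and pos: "0 < (\<integral>z. exp (\<kappa> * \<delta> * gsum z) * exp (H t x z) \<partial>M)"
  shows "ln (\<integral>z. exp (\<kappa> * \<delta> * gsum z) * exp (H t x z) \<partial>M) \<le> C0 * (1 + xsum x)"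
proof -
  have "ln (\<integral>z. exp (\<kappa> * \<delta> * gsum z) * exp (H t x z) \<partial>M) \<le> ln (exp (xsum x / (4 * \<kappa>)) * (\<integral>z. D z \<partial>M))"
    using Z_upper[OF t \<delta>, of x] pos less_le_trans[OF pos Z_upper[OF t \<delta>, of x]] by (subst ln_le_cancel_iff) auto
  also have "\<dots> = xsum x * (1 / (4 * \<kappa>)) + ln (\<integral>z. D z \<partial>M)"
    using D_pos by (simp add: ln_mult)
  also have "\<dots> \<le> (1 + xsum x) * (1 / (4 * \<kappa>)) + \<bar>ln (\<integral>z. D z \<partial>M)\<bar> * (1 + xsum x)"
  proof (rule add_mono)
    show "xsum x * (1 / (4 * \<kappa>)) \<le> (1 + xsum x) * (1 / (4 * \<kappa>))"
      using kappa by (intro mult_right_mono) auto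
    have "\<bar>ln (\<integral>z. D z \<partial>M)\<bar> * 1 \<le> \<bar>ln (\<integral>z. D z \<partial>M)\<bar> * (1 + xsum x)"
      using xsum_nonneg by (intro mult_left_mono) auto
    then show "ln (\<integral>z. D z \<partial>M) \<le> \<bar>ln (\<integral>z. D z \<partial>M)\<bar> * (1 + xsum x)" by linarith
  qed
  also have "\<dots> = (1 / (4 * \<kappa>) + \<bar>ln (\<integral>z. D z \<partial>M)\<bar>) * (1 + xsum x)" by (simp add: algebra_simps)
  also have "\<dots> \<le> C0 * (1 + xsum x)"
    unfolding C0_def using xsum_nonneg
    by (intro mult_right_mono) (auto intro!: sum_nonneg add_nonneg_nonneg)
  finally show ?thesis .
qed

text \<open>The Jensen bound, the integral of H over M, is affine in x, and |x_k| <= 1 + x_k^2 puts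
  it into the same quadratic form as the upper bound.\<close>

lemma ln_Z_lower:
  assumes t: "0 \<le> t" "t \<le> 1"
  shows "- (C0 * (1 + xsum x)) \<le> ln (Z t x)"
proof -
  let ?G = "\<lambda>k. \<integral>z. \<bar>g k z\<bar> \<partial>M" and ?S = "\<lambda>k. \<integral>z. (g k z)\<^sup>2 \<partial>M"
  have G: "0 \<le> ?G k" "0 \<le> ?S k" for k by auto
  have b: "- ((?G k + ?S k) * (1 + xsum x)) \<le> sqrt (s k t) * x k * (\<integral>z. g k z \<partial>M) - s k t * ?S k / 2" if k: "k \<in> K" for k
  proof -
    have "\<bar>sqrt (s k t) * x k * (\<integral>z. g k z \<partial>M)\<bar> \<le> (1 * (1 + xsum x)) * ?G k"
      unfolding abs_mult
    proof (intro mult_mono)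
      have "0 \<le> (\<bar>x k\<bar> - 1)\<^sup>2" by simp
      then show "\<bar>x k\<bar> \<le> 1 + xsum x" using xsum_ge[OF k, of x] by (simp add: power2_diff)
      show "\<bar>\<integral>z. g k z \<partial>M\<bar> \<le> ?G k" using integral_norm_bound[of M "g k"] by simp
    qed (use s_nonneg[OF k t] s_le_one[OF k t] xsum_nonneg in auto)
    moreover have "s k t * ?S k / 2 \<le> ?S k * (1 + xsum x)"
    proof -
      have "s k t * ?S k / 2 \<le> 1 * ?S k"
        using s_le_one[OF k t] mult_right_mono[of "s k t" 1 "?S k"] G[of k] by linarith
      also have "\<dots> \<le> ?S k * (1 + xsum x)" using G xsum_nonneg mult_left_mono[of 1 "1 + xsum x" "?S k"] by simp
      finally show ?thesis .
    qed
    ultimately show ?thesis by (simp add: algebra_simps abs_le_iff)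
  qed
  have "- (C0 * (1 + xsum x)) \<le> - ((\<Sum>k\<in>K. ?G k + ?S k) * (1 + xsum x)) - \<bar>\<integral>z. w z \<partial>M\<bar> * (1 + xsum x)"
  proof -
    have "0 \<le> (1 / (4 * \<kappa>) + \<bar>ln (\<integral>z. D z \<partial>M)\<bar>) * (1 + xsum x)"
      using kappa xsum_nonneg by (intro mult_nonneg_nonneg add_nonneg_nonneg) auto
    then show ?thesis unfolding C0_def by (simp add: algebra_simps)
  qed
  also have "\<dots> \<le> - ((\<Sum>k\<in>K. ?G k + ?S k) * (1 + xsum x)) + (\<integral>z. w z \<partial>M)"
  proof -
    have "\<bar>\<integral>z. w z \<partial>M\<bar> * 1 \<le> \<bar>\<integral>z. w z \<partial>M\<bar> * (1 + xsum x)"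
      using xsum_nonneg by (intro mult_left_mono) auto
    then show ?thesis by linarith
  qed
  also have "\<dots> = (\<Sum>k\<in>K. - ((?G k + ?S k) * (1 + xsum x))) + (\<integral>z. w z \<partial>M)"
    by (simp add: sum_distrib_right sum_negf)
  also have "\<dots> \<le> (\<Sum>k\<in>K. sqrt (s k t) * x k * (\<integral>z. g k z \<partial>M) - s k t * ?S k / 2) + (\<integral>z. w z \<partial>M)"
    by (intro add_right_mono sum_mono b)
  also have "\<dots> = (\<integral>z. H t x z \<partial>M)"
    unfolding H_def using g_sq integrable_g w_int by simp
  also have "\<dots> \<le> ln (Z t x)" by (rule Z_lower[OF t])
  finally show ?thesis .
qed

lemma abs_ln_Z:
  assumes t: "0 \<le> t" "t \<le> 1"
  shows "\<bar>ln (Z t x)\<bar> \<le> C0 * (1 + xsum x)"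
proof -
  have "ln (Z t x) \<le> C0 * (1 + xsum x)"
    using ln_Z_upper[OF t s_nonneg[OF _ t], where x=x] Z_lower(1)[OF t, of x] by (simp add: Z_def)
  with ln_Z_lower[OF t, of x] show ?thesis by (simp add: abs_le_iff)
qed

lemma C0_nonneg: "0 \<le> C0"
  unfolding C0_def using kappa by (intro add_nonneg_nonneg sum_nonneg) auto

section \<open>Joint measurability, and continuity of the free energy on the closed interval\<close>

lemma integrable_xsum: "integrable P (\<lambda>x. C * (1 + xsum x))"
proof -
  interpret PP: prob_space P by (rule prob_space_P)
  have "integrable P (\<lambda>x. (x k)\<^sup>2)" if "k \<in> K" for k
    unfolding P_def using that integrable_stdG_square
    by (intro integrable_PiM_stdG_component[where f="\<lambda>x. x\<^sup>2"]) auto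
  then show ?thesis unfolding xsum_def by auto
qed

text \<open>Joint in (t, x): fixing t gives measurability in the disorder, and for
  \<open>avg\<close> the same joint form gives measurability in t after integrating out x.\<close>

lemma Z_meas[measurable]: "(\<lambda>p. Z (fst p) (snd p)) \<in> borel_measurable (borel \<Otimes>\<^sub>M P)"
  unfolding Z_def H_def s_def by measurable

lemma avg_meas[measurable]:
  assumes [measurable]: "f \<in> borel_measurable M"
  shows "(\<lambda>p. avg (fst p) (snd p) f) \<in> borel_measurable (borel \<Otimes>\<^sub>M P)"
  unfolding avg_def Z_def H_def s_def by measurable

text \<open>Two nested dominated convergences: over z for fixed x, with a multiple of
  \<open>D\<close>, and then over x, with the quadratic bound of \<open>abs_ln_Z\<close>. Both
  bounds are uniform up to the endpoints.\<close>

lemma continuous_on_\<phi>: "continuous_on {0..1} \<phi>"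
  unfolding \<phi>_def
proof (rule continuous_on_lebesgue_integral[where B="\<lambda>x. C0 * (1 + xsum x)"])
  show "(\<lambda>x. ln (Z t x)) \<in> borel_measurable P" for t
    using measurable_compose[OF measurable_Pair1' Z_meas, of t] by (intro borel_measurable_ln) simp
  show "continuous_on {0..1} (\<lambda>t. ln (Z t x))" for x
  proof (rule continuous_on_ln)
    show "\<forall>t\<in>{0..1}. Z t x \<noteq> 0" by (metis Z_lower(1) atLeastAtMost_iff less_irrefl)
    show "continuous_on {0..1} (\<lambda>t. Z t x)"
      unfolding Z_def
    proof (rule continuous_on_lebesgue_integral)
      show "integrable M (\<lambda>z. exp (xsum x / (4 * \<kappa>)) * D z)" using D_int by auto
      show "continuous_on {0..1} (\<lambda>t. exp (H t x z))" for z
        unfolding H_def s_def by (intro continuous_intros) auto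
    qed (use exp_H_bound in auto)
  qed
qed (use abs_ln_Z integrable_xsum in auto)

end

section \<open>The derivative of the interpolated free energy\<close>

context wick_interpolation
begin

section \<open>Gibbs moments at interior times\<close>

lemma integrable_exp_g:
  assumes t: "0 < t" "t < 1" and k: "k \<in> K"
  shows "integrable M (\<lambda>z. exp (r * \<bar>g k z\<bar>) * exp (H t x z))"
proof -
  define \<delta> where "\<delta> = min t (1 - t)"
  have \<delta>: "0 < \<delta>" "\<And>k. k \<in> K \<Longrightarrow> \<delta> \<le> s k t"
    using t s_ge[of _ t] by (auto simp: \<delta>_def s_def)
  \<comment> \<open>Completing the square in |g| against the Gaussian rate
    \<open>\<kappa> * \<delta>\<close>, which is positive only because t is interior. So every
    exponential rate r is allowed.\<close>
  have le: "exp (r * \<bar>g k z\<bar>) \<le> exp (r\<^sup>2 / (4 * (\<kappa> * \<delta>))) * exp (\<kappa> * \<delta> * gsum z)" for z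
  proof -
    have "0 \<le> (r - 2 * (\<kappa> * \<delta>) * \<bar>g k z\<bar>)\<^sup>2" by simp
    then have "r * \<bar>g k z\<bar> \<le> r\<^sup>2 / (4 * (\<kappa> * \<delta>)) + \<kappa> * \<delta> * (g k z)\<^sup>2"
      using kappa \<delta>(1) by (simp add: power2_diff power_mult_distrib field_simps power2_eq_square)
    also have "\<kappa> * \<delta> * (g k z)\<^sup>2 \<le> \<kappa> * \<delta> * gsum z"
      using kappa \<delta>(1) gsum_ge[OF k] by (intro mult_left_mono) auto
    finally show ?thesis by (simp add: exp_add[symmetric])
  qed
  show ?thesis
  proof (rule Bochner_Integration.integrable_bound[of _
        "\<lambda>z. exp (r\<^sup>2 / (4 * (\<kappa> * \<delta>))) * (exp (\<kappa> * \<delta> * gsum z) * exp (H t x z))"])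
    show "integrable M (\<lambda>z. exp (r\<^sup>2 / (4 * (\<kappa> * \<delta>))) * (exp (\<kappa> * \<delta> * gsum z) * exp (H t x z)))"
      using integrable_exp_gsum[of t \<delta> x] \<delta> t by auto
    show "AE z in M. norm (exp (r * \<bar>g k z\<bar>) * exp (H t x z))
        \<le> norm (exp (r\<^sup>2 / (4 * (\<kappa> * \<delta>))) * (exp (\<kappa> * \<delta> * gsum z) * exp (H t x z)))"
    proof (rule AE_I2)
      fix z show "norm (exp (r * \<bar>g k z\<bar>) * exp (H t x z))
        \<le> norm (exp (r\<^sup>2 / (4 * (\<kappa> * \<delta>))) * (exp (\<kappa> * \<delta> * gsum z) * exp (H t x z)))"
        using mult_right_mono[OF le[of z], of "exp (H t x z)"] by (simp add: abs_mult mult.assoc)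
    qed
  qed (use k in measurable)
qed

lemma integrable_g_power:
  assumes "0 < t" "t < 1" "k \<in> K"
  shows "integrable M (\<lambda>z. g k z ^ n * exp (H t x z))"
  using DERIV_exponential_moment(1)[of "\<lambda>z. exp (H t x z)" M "g k" n 0] assms integrable_exp_g by simp

lemma integrable_g_exp_H:
  assumes "0 < t" "t < 1" "k \<in> K"
  shows "integrable M (\<lambda>z. g k z * exp (H t x z))"
  using integrable_g_power[OF assms, of 1] by simp

text \<open>The Gibbs variance of g_k is nonnegative.\<close>

lemma avg_g_square:
  assumes t: "0 < t" "t < 1" and k: "k \<in> K"
  shows "(avg t x (g k))\<^sup>2 \<le> avg t x (\<lambda>z. (g k z)\<^sup>2)"
proof -
  define m where "m = avg t x (g k)"
  have Z: "0 < Z t x" using Z_lower t by auto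
  have i: "integrable M (\<lambda>z. exp (H t x z))" using integrable_exp_H t by auto
  have "0 \<le> (\<integral>z. (g k z - m)\<^sup>2 * exp (H t x z) \<partial>M)" by (rule Bochner_Integration.integral_nonneg) auto
  also have "\<dots> = (\<integral>z. (g k z)\<^sup>2 * exp (H t x z) - 2 * m * (g k z * exp (H t x z)) + m\<^sup>2 * exp (H t x z) \<partial>M)"
    by (simp add: power2_diff algebra_simps)
  also have "\<dots> = (\<integral>z. (g k z)\<^sup>2 * exp (H t x z) \<partial>M) - 2 * m * (\<integral>z. g k z * exp (H t x z) \<partial>M) + m\<^sup>2 * Z t x"
    using integrable_g_power[OF t k, of 2] integrable_g_exp_H[OF t k] i by (simp add: Z_def)
  also have "\<dots> = Z t x * (avg t x (\<lambda>z. (g k z)\<^sup>2) - m\<^sup>2)"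
    using Z by (simp add: avg_def m_def field_simps power2_eq_square)
  finally show ?thesis using Z by (simp add: zero_le_mult_iff m_def)
qed

text \<open>Jensen under the Gibbs weight bounds \<open>\<kappa>\<close> \<open>\<delta>\<close>
  <g_k^2> by the log of an exponential moment minus ln Z. Each logarithm contributes at most C0 (1 +
  |x|^2), which explains the factor 2 and the quadratic, rather than exponential, growth in
  x.\<close>

lemma avg_g_square_le:
  assumes t: "0 < t" "t < 1" and \<delta>: "0 < \<delta>" "\<And>k. k \<in> K \<Longrightarrow> \<delta> \<le> s k t" and k: "k \<in> K"
  shows "avg t x (\<lambda>z. (g k z)\<^sup>2) \<le> 2 * C0 / (\<kappa> * \<delta>) * (1 + xsum x)"
proof -
  have t': "0 \<le> t" "t \<le> 1" using t by auto
  let ?E = "\<lambda>z. exp (H t x z)" and ?h = "\<lambda>z. \<kappa> * \<delta> * (g k z)\<^sup>2"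
  have i2: "integrable M (\<lambda>z. exp (\<kappa> * \<delta> * gsum z) * ?E z)" by (rule integrable_exp_gsum[OF t' \<delta>(2)])
  have le: "exp (?h z) * ?E z \<le> exp (\<kappa> * \<delta> * gsum z) * ?E z" for z
    using gsum_ge[OF k, of z] kappa \<delta>(1) by simp
  have i1: "integrable M (\<lambda>z. exp (?h z) * ?E z)"
    by (rule Bochner_Integration.integrable_bound[OF i2]) (use le k in \<open>auto simp: abs_mult\<close>)
  have Z: "0 < Z t x" by (rule Z_lower[OF t'])
  have ih: "integrable M (\<lambda>z. ?h z * ?E z)"
    using integrable_mult_right[OF integrable_g_power[OF t k, of 2 x], of "\<kappa> * \<delta>"] by (simp add: mult.assoc)
  have iE: "integrable M ?E" by (rule integrable_exp_H[OF t'])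
  have j: "0 < (\<integral>z. exp (?h z) * ?E z \<partial>M)"
    "(\<integral>z. ?h z * ?E z \<partial>M) / Z t x \<le> ln ((\<integral>z. exp (?h z) * ?E z \<partial>M) / Z t x)"
    using gibbs_jensen[of M ?E ?h, OF iE _ _ ih i1] Z by (simp_all add: Z_def)
  have mono: "(\<integral>z. exp (?h z) * ?E z \<partial>M) \<le> (\<integral>z. exp (\<kappa> * \<delta> * gsum z) * ?E z \<partial>M)"
    by (rule integral_mono[OF i1 i2 le])
  have pos: "0 < (\<integral>z. exp (\<kappa> * \<delta> * gsum z) * ?E z \<partial>M)"
    by (rule less_le_trans[OF j(1) mono])
  have "\<kappa> * \<delta> * avg t x (\<lambda>z. (g k z)\<^sup>2) = (\<integral>z. ?h z * ?E z \<partial>M) / Z t x"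
    by (simp add: avg_def mult.assoc)
  also note j(2)
  also have "ln ((\<integral>z. exp (?h z) * ?E z \<partial>M) / Z t x) = ln (\<integral>z. exp (?h z) * ?E z \<partial>M) - ln (Z t x)"
    using j(1) Z by (simp add: ln_div)
  also have "\<dots> \<le> ln (\<integral>z. exp (\<kappa> * \<delta> * gsum z) * ?E z \<partial>M) - ln (Z t x)"
    using mono j(1) pos by simp
  also have "\<dots> \<le> C0 * (1 + xsum x) + C0 * (1 + xsum x)"
    using ln_Z_upper[OF t' \<delta>(2) pos] abs_ln_Z[OF t', of x] by linarith
  finally show ?thesis using kappa \<delta>(1) by (simp add: field_simps)
qed

text \<open>The pair (u, v) is abstract so that the bound applies twice: pointwise with (g, g^2),
  and after averaging with (<g>, <g^2>), where u^2 <= v is \<open>avg_g_square\<close>.\<close>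

lemma H'_term_bound:
  fixes u v y :: real
  assumes k: "k \<in> K" and \<delta>: "0 < \<delta>" "\<delta> \<le> s k t" and uv: "u\<^sup>2 \<le> v"
  shows "\<bar>c k / (2 * sqrt (s k t)) * y * u - c k / 2 * v\<bar> \<le> (1 / (4 * sqrt \<delta>) + 1/2) * (y\<^sup>2 + v)"
proof -
  have v: "0 \<le> v" using uv order_trans zero_le_power2 by blast
  have "\<bar>c k / (2 * sqrt (s k t)) * (y * u)\<bar> \<le> 1 / (2 * sqrt \<delta>) * ((y\<^sup>2 + v) / 2)"
    unfolding abs_mult[of "c k / (2 * sqrt (s k t))"]
  proof (rule mult_mono)
    show "\<bar>c k / (2 * sqrt (s k t))\<bar> \<le> 1 / (2 * sqrt \<delta>)"
      using abs_c_le_one[OF k] \<delta> by (simp add: abs_divide) (intro frac_le, auto)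
    have "0 \<le> (\<bar>y\<bar> - \<bar>u\<bar>)\<^sup>2" by simp
    then show "\<bar>y * u\<bar> \<le> (y\<^sup>2 + v) / 2" using uv by (simp add: power2_diff abs_mult)
  qed (use \<delta> in auto)
  moreover have "\<bar>c k / 2 * v\<bar> \<le> 1/2 * (y\<^sup>2 + v)"
  proof -
    have "\<bar>c k / 2\<bar> * v \<le> 1/2 * v" using abs_c_le_one[OF k] v by (intro mult_right_mono) auto
    then show ?thesis using v by (simp add: abs_mult) (smt (verit) zero_le_power2)
  qed
  ultimately have "\<bar>c k / (2 * sqrt (s k t)) * (y * u) - c k / 2 * v\<bar>
      \<le> 1 / (2 * sqrt \<delta>) * ((y\<^sup>2 + v) / 2) + 1/2 * (y\<^sup>2 + v)" by linarith
  also have "\<dots> = (1 / (4 * sqrt \<delta>) + 1/2) * (y\<^sup>2 + v)" by (simp add: algebra_simps)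
  finally show ?thesis by (simp add: mult.assoc)
qed

lemma abs_H'_le:
  assumes \<delta>: "0 < \<delta>" "\<And>k. k \<in> K \<Longrightarrow> \<delta> \<le> s k t"
  shows "\<bar>H' t x z\<bar> \<le> (1 / (4 * sqrt \<delta>) + 1/2) * (xsum x + gsum z)"
proof -
  have "\<bar>H' t x z\<bar> \<le> (\<Sum>k\<in>K. (1 / (4 * sqrt \<delta>) + 1/2) * ((x k)\<^sup>2 + (g k z)\<^sup>2))"
    unfolding H'_def using H'_term_bound \<delta> by (intro order_trans[OF sum_abs] sum_mono) auto
  then show ?thesis by (simp only: xsum_def gsum_def sum.distrib sum_distrib_left distrib_left)
qed

lemma avg_H':
  assumes t: "0 < t" "t < 1"
  shows "avg t x (H' t x) = (\<Sum>k\<in>K. c k / (2 * sqrt (s k t)) * x k * avg t x (g k) - c k / 2 * avg t x (\<lambda>z. (g k z)\<^sup>2))"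
proof -
  have i: "integrable M (\<lambda>z. g k z * exp (H t x z))" "integrable M (\<lambda>z. (g k z)\<^sup>2 * exp (H t x z))" if "k \<in> K" for k
    using integrable_g_exp_H[OF t that] integrable_g_power[OF t that] by auto
  have "(\<integral>z. H' t x z * exp (H t x z) \<partial>M) =
    (\<integral>z. (\<Sum>k\<in>K. c k / (2 * sqrt (s k t)) * x k * (g k z * exp (H t x z)) - c k / 2 * ((g k z)\<^sup>2 * exp (H t x z))) \<partial>M)"
    unfolding H'_def sum_distrib_right
    by (intro Bochner_Integration.integral_cong sum.cong) (auto simp: algebra_simps)
  also have "\<dots> = (\<Sum>k\<in>K. c k / (2 * sqrt (s k t)) * x k * (\<integral>z. g k z * exp (H t x z) \<partial>M)
      - c k / 2 * (\<integral>z. (g k z)\<^sup>2 * exp (H t x z) \<partial>M))"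
    using i by (subst Bochner_Integration.integral_sum) (auto intro!: sum.cong)
  finally show ?thesis
    by (simp add: avg_def sum_divide_distrib diff_divide_distrib)
qed

lemma abs_avg_H'_le:
  assumes t: "0 < t" "t < 1" and \<delta>: "0 < \<delta>" "\<And>k. k \<in> K \<Longrightarrow> \<delta> \<le> s k t"
  shows "\<bar>avg t x (H' t x)\<bar> \<le>
    (1 / (4 * sqrt \<delta>) + 1/2) * (card K * (1 + 2 * C0 / (\<kappa> * \<delta>))) * (1 + xsum x)"
proof -
  have alg: "n * (A * (X + B * X)) = A * (n * (1 + B)) * X" for n A X B :: real
    by (simp add: algebra_simps)
  have "\<bar>avg t x (H' t x)\<bar> \<le> (\<Sum>k\<in>K. (1 / (4 * sqrt \<delta>) + 1/2) * ((x k)\<^sup>2 + avg t x (\<lambda>z. (g k z)\<^sup>2)))"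
    unfolding avg_H'[OF t] using H'_term_bound \<delta> avg_g_square[OF t]
    by (intro order_trans[OF sum_abs] sum_mono) auto
  also have "\<dots> \<le> (\<Sum>k\<in>K. (1 / (4 * sqrt \<delta>) + 1/2) * ((1 + xsum x) + 2 * C0 / (\<kappa> * \<delta>) * (1 + xsum x)))"
  proof (intro sum_mono mult_left_mono add_mono)
    fix k assume k: "k \<in> K"
    show "(x k)\<^sup>2 \<le> 1 + xsum x" using xsum_ge[OF k, of x] by simp
    show "avg t x (\<lambda>z. (g k z)\<^sup>2) \<le> 2 * C0 / (\<kappa> * \<delta>) * (1 + xsum x)"
      by (rule avg_g_square_le[OF t \<delta> k])
  qed (use \<delta> in auto)
  also have "\<dots> = (1 / (4 * sqrt \<delta>) + 1/2) * (card K * (1 + 2 * C0 / (\<kappa> * \<delta>))) * (1 + xsum x)"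
    by (simp only: sum_constant alg)
  finally show ?thesis .
qed

section \<open>Differentiation under the Gibbs integral and under the disorder integral\<close>

lemma s_ge_nbhd:
  assumes t0: "0 < t0" "t0 < 1" and t: "t0 / 2 < t" "t < (1 + t0) / 2" and k: "k \<in> K"
  shows "min t0 (1 - t0) / 2 \<le> s k t"
proof -
  \<comment> \<open>The neighbourhood ends at the midpoints between t0 and the endpoints, so t and 1
    - t keep at least half of their values at t0.\<close>
  have "min t (1 - t) \<le> s k t" using s_ge[OF k, of t] assms by (simp add: s_def)
  then show ?thesis using t by (simp add: min_def split: if_splits)
qed

lemma DERIV_H:
  assumes t: "0 < t" "t < 1"
  shows "((\<lambda>t. H t x z) has_real_derivative H' t x z) (at t)"
proof -
  have "((\<lambda>t. sqrt (s k t) * x k * g k z - s k t * (g k z)\<^sup>2 / 2) has_real_derivative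
      c k / (2 * sqrt (s k t)) * x k * g k z - c k / 2 * (g k z)\<^sup>2) (at t)" if k: "k \<in> K" for k
  proof -
    have pos: "0 < a k + c k * t" using s_ge[OF k, of t] t by auto
    have 1: "((\<lambda>t. sqrt (s k t)) has_real_derivative c k / (2 * sqrt (s k t))) (at t)"
      unfolding s_def
      by (rule DERIV_cong[OF DERIV_chain2[where f=sqrt and g="\<lambda>t. a k + c k * t", OF DERIV_real_sqrt[OF pos]]])
        (auto intro!: derivative_eq_intros simp: field_simps)
    have 2: "((\<lambda>t. s k t * (g k z)\<^sup>2 / 2) has_real_derivative c k / 2 * (g k z)\<^sup>2) (at t)"
      unfolding s_def by (auto intro!: derivative_eq_intros)
    show ?thesis
      by (rule DERIV_diff[OF DERIV_cmult_right[OF DERIV_cmult_right[OF 1]] 2])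
  qed
  then have "((\<lambda>t. \<Sum>k\<in>K. sqrt (s k t) * x k * g k z - s k t * (g k z)\<^sup>2 / 2) has_real_derivative H' t x z) (at t)"
    unfolding H'_def by (intro DERIV_sum)
  from DERIV_add[OF this DERIV_const[of "w z"]] show ?thesis
    unfolding H_def by simp
qed

lemma DERIV_ln_Z:
  assumes t0: "0 < t0" "t0 < 1"
  shows "((\<lambda>t. ln (Z t x)) has_real_derivative avg t0 x (H' t0 x)) (at t0)"
proof -
  define \<delta> where "\<delta> = min t0 (1 - t0) / 2"
  define A where "A = 1 / (4 * sqrt \<delta>) + 1/2"
  have \<delta>: "0 < \<delta>" using t0 by (simp add: \<delta>_def)
  have A: "0 \<le> A" using \<delta> by (simp add: A_def)
  have nb: "\<And>k. k \<in> K \<Longrightarrow> \<delta> \<le> s k t" "0 < t" "t < 1" if "t0 / 2 < t" "t < (1 + t0) / 2" for t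
    using s_ge_nbhd[OF t0 that] t0 that by (auto simp: \<delta>_def)
  have "((\<lambda>t. Z t x) has_real_derivative (\<integral>z. H' t0 x z * exp (H t0 x z) \<partial>M)) (at t0)"
    unfolding Z_def
  proof (rule DERIV_lebesgue_integral[where B="\<lambda>z. A * (xsum x + 1 / (\<kappa> * \<delta>)) * (exp (xsum x / (4 * \<kappa>)) * D z)"])
    show "t0 / 2 < t0" "t0 < (1 + t0) / 2" using t0 by auto
    fix t assume t: "t0 / 2 < t" "t < (1 + t0) / 2"
    note nb = nb[OF t]
    show "integrable M (\<lambda>z. exp (H t x z))" using integrable_exp_H nb by auto
    fix z assume z: "z \<in> space M"
    show "((\<lambda>t. exp (H t x z)) has_real_derivative H' t x z * exp (H t x z)) (at t)"
      using DERIV_chain2[OF DERIV_exp DERIV_H[OF nb(2,3)]] by (simp add: mult.commute)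
    \<comment> \<open>The linear growth of \<open>H'\<close> in \<open>gsum\<close> is traded for
      the exponential weight that \<open>H_bound\<close> controls, at the price 1 /
      (\<open>\<kappa> * \<delta>\<close>).\<close>
    have "\<kappa> * \<delta> * gsum z \<le> exp (\<kappa> * \<delta> * gsum z)"
      using exp_ge_add_one_self[of "\<kappa> * \<delta> * gsum z"] by linarith
    then have "gsum z \<le> 1 / (\<kappa> * \<delta>) * exp (\<kappa> * \<delta> * gsum z)"
      using kappa \<delta> by (simp add: pos_le_divide_eq mult.commute)
    moreover have "xsum x * 1 \<le> xsum x * exp (\<kappa> * \<delta> * gsum z)"
      using xsum_nonneg gsum_nonneg kappa \<delta> by (intro mult_left_mono) auto
    ultimately have "xsum x + gsum z \<le> (xsum x + 1 / (\<kappa> * \<delta>)) * exp (\<kappa> * \<delta> * gsum z)"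
      by (simp add: algebra_simps)
    then have "\<bar>H' t x z\<bar> \<le> A * ((xsum x + 1 / (\<kappa> * \<delta>)) * exp (\<kappa> * \<delta> * gsum z))"
      using abs_H'_le[OF \<delta> nb(1), of x z] A unfolding A_def[symmetric]
      by (meson mult_left_mono order_trans)
    then have "\<bar>H' t x z\<bar> * exp (H t x z) \<le> A * ((xsum x + 1 / (\<kappa> * \<delta>)) * exp (\<kappa> * \<delta> * gsum z)) * exp (H t x z)"
      by (rule mult_right_mono) simp
    also have "\<dots> = A * (xsum x + 1 / (\<kappa> * \<delta>)) * (exp (\<kappa> * \<delta> * gsum z) * exp (H t x z))"
      by (simp add: mult.assoc)
    also have "\<dots> \<le> A * (xsum x + 1 / (\<kappa> * \<delta>)) * (exp (xsum x / (4 * \<kappa>)) * D z)"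
      using A xsum_nonneg kappa \<delta> nb z by (intro mult_left_mono H_bound mult_nonneg_nonneg add_nonneg_nonneg) auto
    finally show "\<bar>H' t x z * exp (H t x z)\<bar> \<le> A * (xsum x + 1 / (\<kappa> * \<delta>)) * (exp (xsum x / (4 * \<kappa>)) * D z)"
      by (simp add: abs_mult)
  next
    show "integrable M (\<lambda>z. A * (xsum x + 1 / (\<kappa> * \<delta>)) * (exp (xsum x / (4 * \<kappa>)) * D z))"
      using D_int by auto
    show "(\<lambda>z. H' t0 x z * exp (H t0 x z)) \<in> borel_measurable M"
      unfolding H'_def by measurable
  qed
  moreover have "0 < Z t0 x" using Z_lower t0 by auto
  ultimately show ?thesis unfolding avg_def
    by (auto intro!: derivative_eq_intros simp: field_simps)
qed

lemma Z_meas_x[measurable]: "Z t \<in> borel_measurable P"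
proof -
  have "Pair t \<in> measurable P (borel \<Otimes>\<^sub>M P)" by measurable
  from measurable_compose[OF this Z_meas] show ?thesis by simp
qed

lemma avg_meas_x[measurable]:
  assumes f: "f \<in> borel_measurable M"
  shows "(\<lambda>x. avg t x f) \<in> borel_measurable P"
proof -
  have "Pair t \<in> measurable P (borel \<Otimes>\<^sub>M P)" by measurable
  from measurable_compose[OF this avg_meas[OF f]] show ?thesis by simp
qed

text \<open>Second interchange: the averaged derivative grows at most quadratically in x, with a
  constant depending only on \<open>\<delta>\<close> and hence uniform near t0.\<close>

lemma DERIV_\<phi>_avg:
  assumes t0: "0 < t0" "t0 < 1"
  shows "(\<phi> has_real_derivative (\<integral>x. avg t0 x (H' t0 x) \<partial>P)) (at t0)"
proof -
  define \<delta> where "\<delta> = min t0 (1 - t0) / 2"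
  have \<delta>: "0 < \<delta>" using t0 by (simp add: \<delta>_def)
  have nb: "\<And>k. k \<in> K \<Longrightarrow> \<delta> \<le> s k t" "0 < t" "t < 1" if "t0 / 2 < t" "t < (1 + t0) / 2" for t
    using s_ge_nbhd[OF t0 that] t0 that by (auto simp: \<delta>_def)
  let ?B = "\<lambda>x. (1 / (4 * sqrt \<delta>) + 1/2) * (card K * (1 + 2 * C0 / (\<kappa> * \<delta>))) * (1 + xsum x)"
  show ?thesis unfolding \<phi>_def
  proof (rule DERIV_lebesgue_integral[where B="?B"])
    show "t0 / 2 < t0" "t0 < (1 + t0) / 2" using t0 by auto
    fix t assume t: "t0 / 2 < t" "t < (1 + t0) / 2"
    note nb = nb[OF t]
    show "integrable P (\<lambda>x. ln (Z t x))"
    proof (rule Bochner_Integration.integrable_bound[OF integrable_xsum[of C0]])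
      show "AE x in P. norm (ln (Z t x)) \<le> norm (C0 * (1 + xsum x))"
        using abs_ln_Z[of t] nb by (auto intro: order_trans[OF _ abs_ge_self])
    qed simp
    fix x
    show "((\<lambda>t. ln (Z t x)) has_real_derivative avg t x (H' t x)) (at t)"
      by (rule DERIV_ln_Z[OF nb(2,3)])
    show "\<bar>avg t x (H' t x)\<bar> \<le> ?B x"
      by (rule abs_avg_H'_le[OF nb(2,3) \<delta> nb(1)])
  next
    show "integrable P ?B" by (rule integrable_xsum)
    show "(\<lambda>x. avg t0 x (H' t0 x)) \<in> borel_measurable P"
      unfolding avg_H'[OF t0] by measurable
  qed
qed

section \<open>Gaussian integration by parts in one disorder coordinate\<close>

lemma H_upd:
  assumes k: "k \<in> K"
  shows "H t (x(k := y)) z = sqrt (s k t) * y * g k z + H t (x(k := 0)) z"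
proof -
  have "(\<Sum>i\<in>K - {k}. sqrt (s i t) * (x(k := y)) i * g i z - s i t * (g i z)\<^sup>2 / 2) =
        (\<Sum>i\<in>K - {k}. sqrt (s i t) * (x(k := 0)) i * g i z - s i t * (g i z)\<^sup>2 / 2)"
    by (rule sum.cong) auto
  then show ?thesis unfolding H_def by (simp add: sum.remove[OF finK k])
qed

lemma xsum_upd:
  assumes k: "k \<in> K"
  shows "xsum (x(k := y)) = y\<^sup>2 + xsum (x(k := 0))"
proof -
  have "(\<Sum>i\<in>K - {k}. ((x(k := y)) i)\<^sup>2) = (\<Sum>i\<in>K - {k}. ((x(k := 0)) i)\<^sup>2)"
    by (rule sum.cong) auto
  then show ?thesis unfolding xsum_def by (simp add: sum.remove[OF finK k])
qed

text \<open>With the other coordinates frozen, x_k enters only through exp (r g_k), r = sqrt s_k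
  x_k. The averages are ratios of moments \<open>I n r\<close> whose derivatives are
  \<open>I (Suc n) r\<close>, so the quotient rule produces sqrt s_k times the Gibbs variance.
  Continuity of this derivative is a premise of \<open>std_normal_stein\<close>.\<close>

lemma
  assumes t: "0 < t" "t < 1" and k: "k \<in> K"
  shows DERIV_avg_g: "((\<lambda>y. avg t (x(k := y)) (g k)) has_real_derivative
      sqrt (s k t) * (avg t (x(k := y)) (\<lambda>z. (g k z)\<^sup>2) - (avg t (x(k := y)) (g k))\<^sup>2)) (at y)" (is ?A)
    and isCont_avg_g_variance:
      "isCont (\<lambda>y. sqrt (s k t) * (avg t (x(k := y)) (\<lambda>z. (g k z)\<^sup>2) - (avg t (x(k := y)) (g k))\<^sup>2)) y" (is ?B)
proof -
  define E0 where "E0 z = exp (H t (x(k := 0)) z)" for z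
  define I where "I n r = (\<integral>z. g k z ^ n * (exp (r * g k z) * E0 z) \<partial>M)" for n r
  have dI: "(I n has_real_derivative I (Suc n) r) (at r)" for n r
    unfolding I_def E0_def
    by (rule DERIV_exponential_moment(2)) (use integrable_exp_g[OF t k] k in auto)
  have ex: "exp (H t (x(k := y)) z) = exp (sqrt (s k t) * y * g k z) * E0 z" for y z
    using H_upd[OF k, of t x y z] by (simp add: exp_add E0_def)
  have Z: "Z t (x(k := y)) = I 0 (sqrt (s k t) * y)" for y
    unfolding Z_def I_def ex by simp
  have Zpos: "0 < I 0 (sqrt (s k t) * y)" for y
    using Z_lower(1)[of t "x(k := y)"] t by (simp add: Z)
  have av: "avg t (x(k := y)) (g k) = I 1 (sqrt (s k t) * y) / I 0 (sqrt (s k t) * y)"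
    "avg t (x(k := y)) (\<lambda>z. (g k z)\<^sup>2) = I 2 (sqrt (s k t) * y) / I 0 (sqrt (s k t) * y)" for y
    unfolding avg_def Z by (simp_all add: I_def ex)
  have dI': "((\<lambda>y. I n (sqrt (s k t) * y)) has_real_derivative I (Suc n) (sqrt (s k t) * y) * sqrt (s k t)) (at y)" for n y
    by (rule DERIV_chain2[OF dI]) (auto intro!: derivative_eq_intros)
  have c: "isCont (\<lambda>y. I n (sqrt (s k t) * y)) y" for n y
    using dI' DERIV_isCont by blast
  have alg: "(i2 * r * i0 - i1 * (i1 * r)) / (i0 * i0) = r * (i2 / i0 - (i1 / i0)\<^sup>2)"
    if "0 < i0" for i0 i1 i2 r :: real
    using that by (simp add: field_simps power2_eq_square)
  have d0: "((\<lambda>y. I 0 (sqrt (s k t) * y)) has_real_derivative I 1 (sqrt (s k t) * y) * sqrt (s k t)) (at y)"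
    using dI'[of 0 y] by simp
  have d1: "((\<lambda>y. I 1 (sqrt (s k t) * y)) has_real_derivative I 2 (sqrt (s k t) * y) * sqrt (s k t)) (at y)"
    using dI'[of 1 y] by (simp add: numeral_2_eq_2)
  show ?A unfolding av
    using DERIV_divide[OF d1 d0] Zpos[of y] alg[OF Zpos[of y]] by simp
  have q: "isCont (\<lambda>y. I n (sqrt (s k t) * y) / I 0 (sqrt (s k t) * y)) y" for n
    using Zpos[of y] by (intro isCont_divide c) auto
  show ?B unfolding av
    by (intro isCont_mult isCont_diff isCont_power continuous_const q)
qed

text \<open>Stein's identity in x_k for <g_k>, whose x_k-derivative is sqrt s_k times the Gibbs
  variance. The integrability statements allow the variance to be split into the two integrals and
  the result to be summed over k.\<close>

lemma stein_avg_g: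
  assumes t: "0 < t" "t < 1" and k: "k \<in> K"
  shows "integrable P (\<lambda>x. x k * avg t x (g k))"
    and "integrable P (\<lambda>x. avg t x (\<lambda>z. (g k z)\<^sup>2))"
    and "integrable P (\<lambda>x. (avg t x (g k))\<^sup>2)"
    and "(\<integral>x. x k * avg t x (g k) \<partial>P) =
      sqrt (s k t) * ((\<integral>x. avg t x (\<lambda>z. (g k z)\<^sup>2) \<partial>P) - (\<integral>x. (avg t x (g k))\<^sup>2 \<partial>P))"
proof -
  define \<delta> where "\<delta> = min t (1 - t)"
  have \<delta>: "0 < \<delta>" "\<And>k. k \<in> K \<Longrightarrow> \<delta> \<le> s k t"
    using t s_ge[of _ t] by (auto simp: \<delta>_def s_def)
  define C where "C = 2 * C0 / (\<kappa> * \<delta>)"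
  have C: "0 \<le> C" using C0_nonneg kappa \<delta>(1) by (simp add: C_def)
  have b2: "avg t x (\<lambda>z. (g k z)\<^sup>2) \<le> C * (1 + xsum x)" for x
    unfolding C_def by (rule avg_g_square_le[OF t \<delta> k])
  have nn: "(avg t x (g k))\<^sup>2 \<le> avg t x (\<lambda>z. (g k z)\<^sup>2)" for x by (rule avg_g_square[OF t k])
  have nn2: "0 \<le> avg t x (\<lambda>z. (g k z)\<^sup>2)" for x using nn order_trans zero_le_power2 by blast
  have xk[measurable]: "(\<lambda>x. x k) \<in> borel_measurable P"
    using k by (simp add: measurable_cong_sets[OF sets_P refl])
  have [measurable]: "g k \<in> borel_measurable M" using k by simp
  show i1: "integrable P (\<lambda>x. x k * avg t x (g k))"
  proof (rule Bochner_Integration.integrable_bound[OF integrable_xsum[of "1 + C"]])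
    show "AE x in P. norm (x k * avg t x (g k)) \<le> norm ((1 + C) * (1 + xsum x))"
    proof (rule AE_I2)
      fix x
      have "0 \<le> (\<bar>x k\<bar> - \<bar>avg t x (g k)\<bar>)\<^sup>2" by simp
      then have "2 * \<bar>x k * avg t x (g k)\<bar> \<le> (x k)\<^sup>2 + (avg t x (g k))\<^sup>2"
        by (simp add: power2_diff abs_mult)
      also have "\<dots> \<le> (1 + xsum x) + C * (1 + xsum x)"
        using xsum_ge[OF k, of x] nn[of x] b2[of x] by linarith
      also have "\<dots> = (1 + C) * (1 + xsum x)" by (simp add: algebra_simps)
      finally have "2 * \<bar>x k * avg t x (g k)\<bar> \<le> (1 + C) * (1 + xsum x)" .
      then have "\<bar>x k * avg t x (g k)\<bar> \<le> (1 + C) * (1 + xsum x)" by linarith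
      then show "norm (x k * avg t x (g k)) \<le> norm ((1 + C) * (1 + xsum x))"
        by (simp only: real_norm_def)
    qed
  qed measurable
  show i2: "integrable P (\<lambda>x. avg t x (\<lambda>z. (g k z)\<^sup>2))"
  proof (rule Bochner_Integration.integrable_bound[OF integrable_xsum[of C]])
    show "AE x in P. norm (avg t x (\<lambda>z. (g k z)\<^sup>2)) \<le> norm (C * (1 + xsum x))"
      using b2 nn2 by (intro AE_I2) (auto intro: order_trans[OF _ abs_ge_self])
  qed measurable
  show i3: "integrable P (\<lambda>x. (avg t x (g k))\<^sup>2)"
    by (rule Bochner_Integration.integrable_bound[OF i2]) (use nn nn2 in auto)
  \<comment> \<open>Coordinate k is separated from the rest, so that Fubini reduces the claim to the
    one-dimensional identity with the rest fixed.\<close>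
  define L where "L = K - {k}"
  have L: "finite L" "k \<notin> L" "insert k L = K" using k by (auto simp: L_def)
  interpret ps: product_sigma_finite "\<lambda>_::'k. stdG"
    by (simp add: product_sigma_finite_def stdG.sigma_finite_measure_axioms)
  have ins: "(\<integral>x. f x \<partial>P) = (\<integral>x. (\<integral>y. f (x(k := y)) \<partial>stdG) \<partial>PiM L (\<lambda>_. stdG))" if "integrable P f" for f :: "_ \<Rightarrow> real"
    using ps.product_integral_insert[OF L(1,2), of f] that by (simp add: L(3) P_def)
  have "(\<integral>x. x k * avg t x (g k) \<partial>P)
     = (\<integral>x. (\<integral>y. y * avg t (x(k := y)) (g k) \<partial>stdG) \<partial>PiM L (\<lambda>_. stdG))"
    using ins[OF i1] by simp
  also have "\<dots> = (\<integral>x. (\<integral>y. sqrt (s k t) * (avg t (x(k := y)) (\<lambda>z. (g k z)\<^sup>2) - (avg t (x(k := y)) (g k))\<^sup>2) \<partial>stdG) \<partial>PiM L (\<lambda>_. stdG))"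
  proof (rule Bochner_Integration.integral_cong[OF refl])
    fix x :: "'k \<Rightarrow> real"
    define R where "R = xsum (x(k := 0))"
    have R: "0 \<le> R" by (simp add: R_def xsum_nonneg)
    have le: "1 + xsum (x(k := y)) \<le> (1 + R) * (1 + y\<^sup>2)" for y
      using R by (simp add: xsum_upd[OF k, of x y] R_def[symmetric] algebra_simps)
    have b2': "avg t (x(k := y)) (\<lambda>z. (g k z)\<^sup>2) \<le> C * ((1 + R) * (1 + y\<^sup>2))" for y
      using order_trans[OF b2 mult_left_mono[OF le C]] .
    have ge1: "1 * 1 \<le> (1 + R) * (1 + y\<^sup>2)" for y using R by (intro mult_mono) auto
    have ge0: "0 \<le> C * ((1 + R) * (1 + y\<^sup>2))" for y using R C by (intro mult_nonneg_nonneg) auto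
    show "(\<integral>y. y * avg t (x(k := y)) (g k) \<partial>stdG) =
      (\<integral>y. sqrt (s k t) * (avg t (x(k := y)) (\<lambda>z. (g k z)\<^sup>2) - (avg t (x(k := y)) (g k))\<^sup>2) \<partial>stdG)"
    proof (rule std_normal_stein[where C="(1 + C) * (1 + R)"])
      fix y
      have "0 \<le> (\<bar>avg t (x(k := y)) (g k)\<bar> - 1)\<^sup>2" by simp
      then have "\<bar>avg t (x(k := y)) (g k)\<bar> \<le> 1 + (avg t (x(k := y)) (g k))\<^sup>2"
        by (simp add: power2_diff)
      also have "\<dots> \<le> (1 + R) * (1 + y\<^sup>2) + C * ((1 + R) * (1 + y\<^sup>2))"
        using nn[of "x(k := y)"] b2'[of y] ge1[of y] by linarith
      finally show "\<bar>avg t (x(k := y)) (g k)\<bar> \<le> (1 + C) * (1 + R) * (1 + y\<^sup>2)"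
        by (simp add: algebra_simps)
      have "\<bar>sqrt (s k t)\<bar> * \<bar>avg t (x(k := y)) (\<lambda>z. (g k z)\<^sup>2) - (avg t (x(k := y)) (g k))\<^sup>2\<bar>
         \<le> 1 * (C * ((1 + R) * (1 + y\<^sup>2)))"
      proof (rule mult_mono)
        show "\<bar>sqrt (s k t)\<bar> \<le> 1" using s_nonneg[OF k, of t] s_le_one[OF k, of t] t by auto
        show "\<bar>avg t (x(k := y)) (\<lambda>z. (g k z)\<^sup>2) - (avg t (x(k := y)) (g k))\<^sup>2\<bar> \<le> C * ((1 + R) * (1 + y\<^sup>2))"
          using nn[of "x(k := y)"] b2'[of y] zero_le_power2[of "avg t (x(k := y)) (g k)"] by linarith
      qed auto
      also have "\<dots> \<le> (1 + C) * (1 + R) * (1 + y\<^sup>2)"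
        using ge1[of y] by (simp add: algebra_simps)
      finally show "\<bar>sqrt (s k t) * (avg t (x(k := y)) (\<lambda>z. (g k z)\<^sup>2) - (avg t (x(k := y)) (g k))\<^sup>2)\<bar>
         \<le> (1 + C) * (1 + R) * (1 + y\<^sup>2)" by (simp add: abs_mult)
    qed (use DERIV_avg_g[OF t k] isCont_avg_g_variance[OF t k] in auto)
  qed
  also have "\<dots> = (\<integral>x. sqrt (s k t) * (avg t x (\<lambda>z. (g k z)\<^sup>2) - (avg t x (g k))\<^sup>2) \<partial>P)"
    using i2 i3 by (intro ins[symmetric]) auto
  also have "\<dots> = sqrt (s k t) * ((\<integral>x. avg t x (\<lambda>z. (g k z)\<^sup>2) \<partial>P) - (\<integral>x. (avg t x (g k))\<^sup>2 \<partial>P))"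
    using i2 i3 by simp
  finally show "(\<integral>x. x k * avg t x (g k) \<partial>P) =
      sqrt (s k t) * ((\<integral>x. avg t x (\<lambda>z. (g k z)\<^sup>2) \<partial>P) - (\<integral>x. (avg t x (g k))\<^sup>2 \<partial>P))" .
qed

lemma DERIV_\<phi>:
  assumes t: "0 < t" "t < 1"
  shows "(\<phi> has_real_derivative - (1/2) * (\<Sum>k\<in>K. c k * (\<integral>x. (avg t x (g k))\<^sup>2 \<partial>P))) (at t)"
proof -
  have "(\<integral>x. avg t x (H' t x) \<partial>P) =
      (\<integral>x. (\<Sum>k\<in>K. c k / (2 * sqrt (s k t)) * (x k * avg t x (g k)) - c k / 2 * avg t x (\<lambda>z. (g k z)\<^sup>2)) \<partial>P)"
    unfolding avg_H'[OF t] by (simp add: mult.assoc)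
  also have "\<dots> = (\<Sum>k\<in>K. c k / (2 * sqrt (s k t)) * (\<integral>x. x k * avg t x (g k) \<partial>P) - c k / 2 * (\<integral>x. avg t x (\<lambda>z. (g k z)\<^sup>2) \<partial>P))"
    using stein_avg_g(1,2)[OF t] by (subst Bochner_Integration.integral_sum) (auto intro!: sum.cong)
  also have "\<dots> = (\<Sum>k\<in>K. - (1/2) * (c k * (\<integral>x. (avg t x (g k))\<^sup>2 \<partial>P)))"
  proof (rule sum.cong[OF refl])
    fix k assume k: "k \<in> K"
    \<comment> \<open>Positivity makes the factor sqrt s_k from Stein's identity cancel the 1 / sqrt
      s_k of \<open>H'\<close>.\<close>
    have "0 < s k t" using s_ge[OF k, of t] t by (auto simp: s_def)
    then show "c k / (2 * sqrt (s k t)) * (\<integral>x. x k * avg t x (g k) \<partial>P) - c k / 2 * (\<integral>x. avg t x (\<lambda>z. (g k z)\<^sup>2) \<partial>P)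
        = - (1/2) * (c k * (\<integral>x. (avg t x (g k))\<^sup>2 \<partial>P))"
      unfolding stein_avg_g(4)[OF t k] by (simp add: field_simps)
  qed
  finally show ?thesis
    using DERIV_\<phi>_avg[OF t] by (simp add: sum_distrib_left)
qed

text \<open>The form of the fundamental theorem that asks for the derivative only inside and for
  continuity on the closed interval, since sqrt s_k need not be differentiable at the
  endpoints.\<close>

lemma has_integral_\<phi>:
  "((\<lambda>t. - (1/2) * (\<Sum>k\<in>K. c k * (\<integral>x. (avg t x (g k))\<^sup>2 \<partial>P))) has_integral (\<phi> 1 - \<phi> 0)) {0..1}"
  using DERIV_\<phi> continuous_on_\<phi>
  by (intro fundamental_theorem_of_calculus_interior)
    (auto simp: has_real_derivative_iff_has_vector_derivative)

lemma measurable_integral_avg_square[measurable]: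
  assumes [measurable]: "f \<in> borel_measurable M"
  shows "(\<lambda>t. \<integral>x. (avg t x f)\<^sup>2 \<partial>P) \<in> borel_measurable borel"
proof -
  interpret PP: prob_space P by (rule prob_space_P)
  have "(\<lambda>p. (avg (fst p) (snd p) f)\<^sup>2) \<in> borel_measurable (borel \<Otimes>\<^sub>M P)" by measurable
  then show ?thesis
    by (intro PP.borel_measurable_lebesgue_integral) (simp add: case_prod_beta)
qed

end

section \<open>Instantiation to the quartic Gaussian spin glass\<close>

lemma (in pair_sigma_finite)
  fixes f :: "'a \<Rightarrow> real" and h :: "'b \<Rightarrow> real"
  assumes f: "integrable M1 f" and h: "integrable M2 h"
  shows integrable_pair_mult: "integrable (M1 \<Otimes>\<^sub>M M2) (\<lambda>p. f (fst p) * h (snd p))"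
    and integral_pair_mult: "(\<integral>p. f (fst p) * h (snd p) \<partial>(M1 \<Otimes>\<^sub>M M2)) = (\<integral>x. f x \<partial>M1) * (\<integral>y. h y \<partial>M2)"
proof -
  have [measurable]: "f \<in> borel_measurable M1" "h \<in> borel_measurable M2" using f h by auto
  show i: "integrable (M1 \<Otimes>\<^sub>M M2) (\<lambda>p. f (fst p) * h (snd p))"
    by (rule Fubini_integrable) (use f h in \<open>auto simp: abs_mult\<close>)
  show "(\<integral>p. f (fst p) * h (snd p) \<partial>(M1 \<Otimes>\<^sub>M M2)) = (\<integral>x. f x \<partial>M1) * (\<integral>y. h y \<partial>M2)"
    using integral_fst'[OF i] f h by simp
qed

context wick_interpolation
begin

text \<open><g_k>^2 is the average of g_k over two independent replicas of the same Gibbs measure.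
  The affine form with \<open>b\<close> and \<open>r\<close> anticipates the expansion of the
  squared overlap deviation.\<close>

lemma two_replica_average:
  assumes t: "0 < t" "t < 1"
  shows "(\<integral>zz. (b + r * (\<Sum>k\<in>K. c k * (g k (fst zz) * g k (snd zz)))) * exp (H t x (fst zz)) * exp (H t x (snd zz)) \<partial>(M \<Otimes>\<^sub>M M))
      / (Z t x)\<^sup>2 = b + r * (\<Sum>k\<in>K. c k * (avg t x (g k))\<^sup>2)"
proof -
  interpret MM: pair_sigma_finite M M ..
  let ?E = "\<lambda>z. exp (H t x z)"
  have iE: "integrable M ?E" using integrable_exp_H t by auto
  have ig: "integrable M (\<lambda>z. g k z * ?E z)" if "k \<in> K" for k by (rule integrable_g_exp_H[OF t that])
  have Z: "0 < Z t x" using Z_lower t by auto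
  have "(\<integral>zz. (b + r * (\<Sum>k\<in>K. c k * (g k (fst zz) * g k (snd zz)))) * ?E (fst zz) * ?E (snd zz) \<partial>(M \<Otimes>\<^sub>M M))
    = (\<integral>zz. b * (?E (fst zz) * ?E (snd zz)) + r * (\<Sum>k\<in>K. c k * ((g k (fst zz) * ?E (fst zz)) * (g k (snd zz) * ?E (snd zz)))) \<partial>(M \<Otimes>\<^sub>M M))"
    by (simp add: algebra_simps sum_distrib_left)
  also have "\<dots> = b * (Z t x * Z t x) + r * (\<Sum>k\<in>K. c k * ((\<integral>z. g k z * ?E z \<partial>M) * (\<integral>z. g k z * ?E z \<partial>M)))"
    using MM.integrable_pair_mult[OF iE iE] MM.integrable_pair_mult[OF ig ig]
    by (simp add: MM.integral_pair_mult[OF iE iE] MM.integral_pair_mult[OF ig ig] Z_def)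
  also have "\<dots> = (b + r * (\<Sum>k\<in>K. c k * (avg t x (g k))\<^sup>2)) * (Z t x)\<^sup>2"
  proof -
    have "(\<integral>z. g k z * ?E z \<partial>M) = avg t x (g k) * Z t x" for k
      using Z by (simp add: avg_def)
    then show ?thesis
      by (simp add: power2_eq_square algebra_simps sum_distrib_left sum_distrib_right)
  qed
  finally show ?thesis using Z by simp
qed

end

section \<open>Gaussian integrals and moments of the squared norm\<close>

lemma
  fixes v b :: real
  assumes v: "0 < v"
  shows integrable_stdG_exp_quadratic: "integrable stdG (\<lambda>x. exp (b * x - (v - 1) / 2 * x\<^sup>2))"
    and integral_stdG_exp_quadratic: "(\<integral>x. exp (b * x - (v - 1) / 2 * x\<^sup>2) \<partial>stdG) = exp (b\<^sup>2 / (2 * v)) / sqrt v"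
proof -
  have eq: "std_normal_density x * exp (b * x - (v - 1) * x\<^sup>2 / 2) =
      exp (b\<^sup>2 / (2 * v)) / sqrt v * normal_density (b / v) (1 / sqrt v) x" for x
  proof -
    \<comment> \<open>Completing the square: including the density of \<open>stdG\<close>, the
      precision is v, so a normal density with mean b / v and variance 1 / v appears.\<close>
    have "- (x\<^sup>2) / 2 + (b * x - (v - 1) * x\<^sup>2 / 2) = b\<^sup>2 / (2 * v) + - ((x - b / v)\<^sup>2) / (2 * (1 / sqrt v)\<^sup>2)"
      using v by (simp add: field_simps power2_eq_square)
    then have "exp (- (x\<^sup>2) / 2) * exp (b * x - (v - 1) * x\<^sup>2 / 2) =
        exp (b\<^sup>2 / (2 * v)) * exp (- ((x - b / v)\<^sup>2) / (2 * (1 / sqrt v)\<^sup>2))"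
      by (simp add: exp_add[symmetric])
    moreover have "sqrt (2 * pi * (1 / sqrt v)\<^sup>2) = sqrt (2 * pi) / sqrt v"
      using v by (simp add: power_divide real_sqrt_divide)
    ultimately show ?thesis
      using v by (simp add: std_normal_density_def normal_density_def)
  qed
  have s: "0 < 1 / sqrt v" using v by simp
  show "integrable stdG (\<lambda>x. exp (b * x - (v - 1) / 2 * x\<^sup>2))"
    unfolding stdG_def using integrable_normal_density[OF s, of "b / v"]
    by (subst integrable_density) (auto simp: eq)
  show "(\<integral>x. exp (b * x - (v - 1) / 2 * x\<^sup>2) \<partial>stdG) = exp (b\<^sup>2 / (2 * v)) / sqrt v"
    unfolding stdG_def using integral_normal_density[OF s, of "b / v"]
    by (subst integral_density) (auto simp: eq)
qed

lemma product_sigma_finite_stdG: "product_sigma_finite (\<lambda>_. stdG)"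
  by (simp add: product_sigma_finite_def stdG.sigma_finite_measure_axioms)

lemma prob_space_gaussN: "prob_space (gaussN N)"
  unfolding gaussN_def by (intro prob_space_PiM prob_space_stdG)

lemma sets_gaussN[measurable_cong]: "sets (gaussN N) = sets (PiM {..<N} (\<lambda>_. borel))"
  unfolding gaussN_def by (intro sets_PiM_cong) auto

lemma sets_disorderN[measurable_cong]: "sets (disorderN N) = sets (PiM ({..<N} \<times> {..<N}) (\<lambda>_. borel))"
  unfolding disorderN_def by (intro sets_PiM_cong) auto

lemma sqnorm_nonneg: "0 \<le> sqnorm N z"
  unfolding sqnorm_def by (intro sum_nonneg) auto

lemma sqnorm_meas[measurable]: "sqnorm N \<in> borel_measurable (gaussN N)"
  unfolding sqnorm_def[abs_def] by measurable

lemma integrable_exp_sqnorm: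
  assumes "m < 1/2"
  shows "integrable (gaussN N) (\<lambda>z. exp (m * sqnorm N z))"
proof -
  interpret ps: product_sigma_finite "\<lambda>_::nat. stdG" by (rule product_sigma_finite_stdG)
  have "integrable stdG (\<lambda>x. exp (m * x\<^sup>2))"
    using integrable_stdG_exp_quadratic[of "1 - 2 * m" 0] assms by simp
  then have "integrable (gaussN N) (\<lambda>z. \<Prod>i<N. exp (m * (z i)\<^sup>2))"
    unfolding gaussN_def by (intro ps.product_integrable_prod) auto
  then show ?thesis by (simp add: sqnorm_def sum_distrib_left exp_sum)
qed

lemma integrable_sqnorm_power: "integrable (gaussN N) (\<lambda>z. C * sqnorm N z ^ n)"
proof (rule Bochner_Integration.integrable_bound[of _ "\<lambda>z. (\<bar>C\<bar> * 4 ^ n * fact n) * exp (1/4 * sqnorm N z)"])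
  show "integrable (gaussN N) (\<lambda>z. (\<bar>C\<bar> * 4 ^ n * fact n) * exp (1/4 * sqnorm N z))"
    by (intro integrable_mult_right integrable_exp_sqnorm) simp
  show "AE z in gaussN N. norm (C * sqnorm N z ^ n) \<le> norm ((\<bar>C\<bar> * 4 ^ n * fact n) * exp (1/4 * sqnorm N z))"
  proof (rule AE_I2)
    fix z
    have "(1/4 * sqnorm N z) ^ n \<le> fact n * exp (1/4 * sqnorm N z)"
      using sqnorm_nonneg by (intro power_le_fact_exp) simp
    then have "sqnorm N z ^ n \<le> 4 ^ n * (fact n * exp (1/4 * sqnorm N z))"
      by (simp add: power_divide field_simps)
    from mult_left_mono[OF this, of "\<bar>C\<bar>"]
    show "norm (C * sqnorm N z ^ n) \<le> norm ((\<bar>C\<bar> * 4 ^ n * fact n) * exp (1/4 * sqnorm N z))"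
      using sqnorm_nonneg[of N z] by (simp add: abs_mult mult.assoc)
  qed
qed measurable

text \<open>Index \<open>Inl (i, j)\<close> carries the coupling \<open>J (i, j)\<close> with variance \<open>t\<close>, index \<open>Inr i\<close> the
  field \<open>J' i\<close> with variance \<open>1 - t\<close>; the variance at \<open>k\<close> is \<open>glass_offset k + glass_slope k * t\<close>.\<close>

definition glass_index :: "nat \<Rightarrow> (nat \<times> nat + nat) set" where
  "glass_index N = ({..<N} \<times> {..<N}) <+> {..<N}"

definition glass_obs :: "nat \<Rightarrow> real \<Rightarrow> real \<Rightarrow> nat \<times> nat + nat \<Rightarrow> (nat \<Rightarrow> real) \<Rightarrow> real" where
  "glass_obs N \<beta> q = case_sum (\<lambda>(i,j) z. \<beta> / sqrt (2 * real N) * (z i * z j)) (\<lambda>i z. \<beta> * sqrt q * z i)"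

definition glass_field :: "nat \<Rightarrow> real \<Rightarrow> (nat \<Rightarrow> real) \<Rightarrow> real" where
  "glass_field N lam z = lam / 2 * sqnorm N z"

definition glass_offset :: "nat \<times> nat + nat \<Rightarrow> real" where
  "glass_offset = case_sum (\<lambda>_. 0) (\<lambda>_. 1)"

definition glass_slope :: "nat \<times> nat + nat \<Rightarrow> real" where
  "glass_slope = case_sum (\<lambda>_. 1) (\<lambda>_. -1)"

lemma sum_glass_index: "(\<Sum>k\<in>glass_index N. f k) = (\<Sum>i<N. \<Sum>j<N. f (Inl (i,j))) + (\<Sum>i<N. f (Inr i))"
  unfolding glass_index_def by (simp add: sum.Plus sum.cartesian_product case_prod_beta)

text \<open>Half of this sum is the quartic term plus the quadratic field term of the interpolating
  Hamiltonian; in particular the choice c = -beta^2 q is what the fields need as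
  counterterm.\<close>

lemma glass_obs_square_sum:
  assumes q: "0 \<le> q"
  shows "(\<Sum>k\<in>glass_index N. (glass_offset k + glass_slope k * t) * (glass_obs N \<beta> q k z)\<^sup>2)
    = t * (\<beta>\<^sup>2 / (2 * real N)) * (sqnorm N z)\<^sup>2 + (1 - t) * (\<beta>\<^sup>2 * q) * sqnorm N z"
proof -
  have "(sqnorm N z)\<^sup>2 = (\<Sum>i<N. \<Sum>j<N. (z i)\<^sup>2 * (z j)\<^sup>2)"
    unfolding sqnorm_def power2_eq_square[of "sum _ _"] by (rule sum_product)
  then show ?thesis
    unfolding sum_glass_index using q
    by (simp add: glass_offset_def glass_slope_def glass_obs_def sqnorm_def sum_distrib_left power_mult_distrib power_divide mult.assoc)
qed

text \<open>The exponent in \<open>dominated\<close> is affine in t, so it is a convex combination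
  of a pure quartic case (t = 1) and a pure quadratic case (t = 0). The first is bounded by a
  constant, the second by m |z|^2 with m < 1/2, and \<open>D\<close> is the product of the two
  exponentials.\<close>

lemma wick_interpolation_glass:
  assumes \<beta>: "\<beta> > 0" and q: "q \<in> Dset \<beta> lam" and N: "N \<ge> 1"
  shows "\<exists>\<kappa> D. wick_interpolation (gaussN N) (glass_index N) (glass_obs N \<beta> q) (glass_field N lam) D glass_offset glass_slope \<kappa>"
proof -
  define v where "v = 1 - lam + \<beta>\<^sup>2 * q"
  have q0: "0 \<le> q" and v: "0 < v" using q by (auto simp: Dset_def v_def)
  define p where "p = \<beta>\<^sup>2 * q"
  have p: "0 \<le> p" using q0 by (simp add: p_def)
  define b where "b = \<beta>\<^sup>2 / (2 * real N)"
  have b: "0 < b" using \<beta> N by (simp add: b_def)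
  \<comment> \<open>The bound 1/8 keeps at least a quarter of b S^2; the other bound makes the loss
    4 \<open>\<kappa>\<close> p at most half of the gap v. Using p + 1 avoids dividing by zero when
    q = 0.\<close>
  define \<kappa> where "\<kappa> = min (1/8) (v / (8 * (p + 1)))"
  have \<kappa>: "0 < \<kappa>" using v p by (auto simp: \<kappa>_def)
  have \<kappa>_le: "\<kappa> \<le> 1/8" unfolding \<kappa>_def by (rule min.cobounded1)
  have \<kappa>p: "4 * \<kappa> * p \<le> v / 2"
  proof -
    have "\<kappa> * p \<le> v / (8 * (p + 1)) * (p + 1)" using v p by (intro mult_mono) (auto simp: \<kappa>_def)
    also have "\<dots> = v / 8" using p by (simp add: field_simps)
    finally show ?thesis by simp
  qed
  \<comment> \<open>The quadratic coefficient left at t = 0 when half of the gap v is given up. The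
    maximum with 0 lets the factor 1 - t be dropped later.\<close>
  define m where "m = max 0 ((1 - v / 2) / 2)"
  have m: "0 \<le> m" by (simp add: m_def)
  have m_less: "m < 1/2" unfolding m_def max_less_iff_conj using v by simp
  define D where "D z = exp (lam\<^sup>2 / (4 * b)) * exp (m * sqnorm N z)" for z :: "nat \<Rightarrow> real"
  have "wick_interpolation (gaussN N) (glass_index N) (glass_obs N \<beta> q) (glass_field N lam) D glass_offset glass_slope \<kappa>"
  proof (intro wick_interpolation.intro wick_interpolation_axioms.intro prob_space_gaussN)
    show "finite (glass_index N)" by (simp add: glass_index_def)
    show meas: "glass_obs N \<beta> q k \<in> borel_measurable (gaussN N)" if "k \<in> glass_index N" for k
      using that unfolding glass_index_def by (auto simp: glass_obs_def)
    show "integrable (gaussN N) (\<lambda>z. (glass_obs N \<beta> q k z)\<^sup>2)" if k: "k \<in> glass_index N" for k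
    proof -
      have le: "(z i)\<^sup>2 \<le> sqnorm N z" if "i < N" for i and z :: "nat \<Rightarrow> real"
        unfolding sqnorm_def using that by (intro member_le_sum) auto
      consider i j where "k = Inl (i, j)" "i < N" "j < N" | i where "k = Inr i" "i < N"
        using k by (auto simp: glass_index_def)
      then show ?thesis
      proof cases
        case 1
        show ?thesis
        proof (rule Bochner_Integration.integrable_bound[OF integrable_sqnorm_power[of N b 2]])
          show "AE z in gaussN N. norm ((glass_obs N \<beta> q k z)\<^sup>2) \<le> norm (b * (sqnorm N z)\<^sup>2)"
          proof (rule AE_I2)
            fix z
            have "b * ((z i)\<^sup>2 * (z j)\<^sup>2) \<le> b * (sqnorm N z * sqnorm N z)"
              using 1 le b sqnorm_nonneg by (intro mult_left_mono mult_mono) auto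
            then show "norm ((glass_obs N \<beta> q k z)\<^sup>2) \<le> norm (b * (sqnorm N z)\<^sup>2)"
              using 1 b by (simp add: glass_obs_def b_def power_mult_distrib power_divide power2_eq_square[of "sqnorm N z"])
          qed
        qed (use meas[OF k] in measurable)
      next
        case 2
        show ?thesis
        proof (rule Bochner_Integration.integrable_bound[OF integrable_sqnorm_power[of N p 1]])
          show "AE z in gaussN N. norm ((glass_obs N \<beta> q k z)\<^sup>2) \<le> norm (p * sqnorm N z ^ 1)"
          proof (rule AE_I2)
            fix z
            have "p * (z i)\<^sup>2 \<le> p * sqnorm N z"
              using 2 le p by (intro mult_left_mono) auto
            then show "norm ((glass_obs N \<beta> q k z)\<^sup>2) \<le> norm (p * sqnorm N z ^ 1)"
              using 2 p q0 sqnorm_nonneg[of N z] by (simp add: glass_obs_def p_def power_mult_distrib)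
          qed
        qed (use meas[OF k] in measurable)
      qed
    qed
    show "integrable (gaussN N) (glass_field N lam)"
      unfolding glass_field_def[abs_def] using integrable_sqnorm_power[of N "lam / 2" 1] by simp
    show "integrable (gaussN N) D"
      unfolding D_def[abs_def] by (intro integrable_mult_right integrable_exp_sqnorm m_less)
    show "0 < \<kappa>" by fact
    show "glass_offset k + glass_slope k * t \<le> 1" if "0 \<le> t" "t \<le> 1" for k t
      using that by (cases k) (auto simp: glass_offset_def glass_slope_def)
    show "min t (1 - t) \<le> glass_offset k + glass_slope k * t" if "0 \<le> t" "t \<le> 1" for k t
      using that by (cases k) (auto simp: glass_offset_def glass_slope_def)
    fix t :: real and z
    assume t: "0 \<le> t" "t \<le> 1"
    define S where "S = sqnorm N z"
    have S: "0 \<le> S" by (simp add: S_def sqnorm_nonneg)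
    have 1: "lam / 2 * S - (1/2 - 2 * \<kappa>) * (b * S\<^sup>2) \<le> lam\<^sup>2 / (4 * b)"
    proof -
      have "1/4 * (b * S\<^sup>2) \<le> (1/2 - 2 * \<kappa>) * (b * S\<^sup>2)"
        using \<kappa>_le b by (intro mult_right_mono) auto
      moreover have "lam / 2 * S \<le> lam\<^sup>2 / (4 * b) + 1/4 * (b * S\<^sup>2)"
      proof -
        have "0 \<le> (lam - b * S)\<^sup>2" by simp
        then show ?thesis using b by (simp add: power2_diff field_simps power2_eq_square)
      qed
      ultimately show ?thesis by linarith
    qed
    have 2: "lam / 2 * S - (1/2 - 2 * \<kappa>) * (p * S) \<le> m * S"
    proof -
      have "lam / 2 - (1/2 - 2 * \<kappa>) * p \<le> m"
      proof -
        have v_p: "v = 1 - lam + p" by (simp add: v_def p_def)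
        define y where "y = \<kappa> * p"
        have "4 * y \<le> v / 2" using \<kappa>p by (simp add: y_def)
        then have "lam / 2 - (p / 2 - 2 * y) \<le> (1 - v / 2) / 2" unfolding v_p by argo
        moreover have "(1/2 - 2 * \<kappa>) * p = p / 2 - 2 * y" by (simp add: y_def algebra_simps)
        ultimately have "lam / 2 - (1/2 - 2 * \<kappa>) * p \<le> (1 - v / 2) / 2" by simp
        then show ?thesis unfolding m_def by (rule max.coboundedI2)
      qed
      from mult_right_mono[OF this S] show ?thesis by (simp add: algebra_simps)
    qed
    have "lam / 2 * S - (1/2 - 2 * \<kappa>) * (t * b * S\<^sup>2 + (1 - t) * p * S)
      = t * (lam / 2 * S - (1/2 - 2 * \<kappa>) * (b * S\<^sup>2)) + (1 - t) * (lam / 2 * S - (1/2 - 2 * \<kappa>) * (p * S))"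
      by (simp add: field_simps)
    also have "\<dots> \<le> t * (lam\<^sup>2 / (4 * b)) + (1 - t) * (m * S)"
      using 1 2 t by (intro add_mono mult_left_mono) auto
    also have "\<dots> \<le> 1 * (lam\<^sup>2 / (4 * b)) + 1 * (m * S)"
      using t b m S by (intro add_mono mult_right_mono) auto
    finally show "exp (glass_field N lam z - (1/2 - 2 * \<kappa>) * (\<Sum>k\<in>glass_index N. (glass_offset k + glass_slope k * t) * (glass_obs N \<beta> q k z)\<^sup>2)) \<le> D z"
      unfolding glass_field_def glass_obs_square_sum[OF q0] D_def exp_add[symmetric] b_def[symmetric] p_def[symmetric] S_def[symmetric]
      by simp
  qed
  then show ?thesis by blast
qed

text \<open>Glues couplings and fields into one family. The restriction puts the result into the
  space of \<open>PiM\<close>, whose elements are \<open>undefined\<close> off the index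
  set.\<close>

definition glass_disorder :: "nat \<Rightarrow> (nat \<times> nat \<Rightarrow> real) \<times> (nat \<Rightarrow> real) \<Rightarrow> nat \<times> nat + nat \<Rightarrow> real" where
  "glass_disorder N p = restrict (case_sum (fst p) (snd p)) (glass_index N)"

text \<open>A product measure is determined by its values on boxes; the preimage of a box under the
  gluing map is a product of two boxes, and the factors multiply over the disjoint sum.\<close>

lemma distr_glass_disorder:
  shows "glass_disorder N \<in> measurable (disorderN N \<Otimes>\<^sub>M gaussN N) (PiM (glass_index N) (\<lambda>_. stdG))"
    and "distr (disorderN N \<Otimes>\<^sub>M gaussN N) (PiM (glass_index N) (\<lambda>_. stdG)) (glass_disorder N) = PiM (glass_index N) (\<lambda>_. stdG)"
proof -
  show m: "glass_disorder N \<in> measurable (disorderN N \<Otimes>\<^sub>M gaussN N) (PiM (glass_index N) (\<lambda>_. stdG))"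
    unfolding glass_disorder_def[abs_def]
  proof (rule measurable_restrict)
    fix k assume "k \<in> glass_index N"
    then show "(\<lambda>p. case_sum (fst p) (snd p) k) \<in> measurable (disorderN N \<Otimes>\<^sub>M gaussN N) stdG"
      by (auto simp: glass_index_def)
  qed
  interpret ps: product_sigma_finite "\<lambda>_::nat \<times> nat + nat. stdG" by (rule product_sigma_finite_stdG)
  interpret ps1: product_sigma_finite "\<lambda>_::nat \<times> nat. stdG" by (rule product_sigma_finite_stdG)
  interpret ps2: product_sigma_finite "\<lambda>_::nat. stdG" by (rule product_sigma_finite_stdG)
  interpret G: prob_space "gaussN N" by (rule prob_space_gaussN)
  show "distr (disorderN N \<Otimes>\<^sub>M gaussN N) (PiM (glass_index N) (\<lambda>_. stdG)) (glass_disorder N) = PiM (glass_index N) (\<lambda>_. stdG)"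
  proof (rule ps.PiM_eqI)
    show "finite (glass_index N)" by (simp add: glass_index_def)
    fix A :: "nat \<times> nat + nat \<Rightarrow> real set"
    assume A: "\<And>k. k \<in> glass_index N \<Longrightarrow> A k \<in> sets stdG"
    have AL: "A (Inl p) \<in> sets stdG" if "p \<in> {..<N} \<times> {..<N}" for p using A that by (auto simp: glass_index_def)
    have AR: "A (Inr i) \<in> sets stdG" if "i \<in> {..<N}" for i using A that by (auto simp: glass_index_def)
    have sp: "space (disorderN N \<Otimes>\<^sub>M gaussN N) = extensional ({..<N} \<times> {..<N}) \<times> extensional {..<N}"
      by (simp add: space_pair_measure disorderN_def gaussN_def space_PiM PiE_def)
    have pre: "glass_disorder N -` (Pi\<^sub>E (glass_index N) A) \<inter> space (disorderN N \<Otimes>\<^sub>M gaussN N)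
        = (Pi\<^sub>E ({..<N} \<times> {..<N}) (\<lambda>p. A (Inl p))) \<times> (Pi\<^sub>E {..<N} (\<lambda>i. A (Inr i)))"
    proof (rule set_eqI)
      fix p :: "(nat \<times> nat \<Rightarrow> real) \<times> (nat \<Rightarrow> real)"
      have "glass_disorder N p \<in> Pi\<^sub>E (glass_index N) A \<longleftrightarrow>
          (\<forall>k\<in>{..<N} \<times> {..<N}. fst p k \<in> A (Inl k)) \<and> (\<forall>i\<in>{..<N}. snd p i \<in> A (Inr i))"
        unfolding glass_disorder_def restrict_PiE_iff glass_index_def Plus_def ball_Un by simp
      then show "p \<in> glass_disorder N -` (Pi\<^sub>E (glass_index N) A) \<inter> space (disorderN N \<Otimes>\<^sub>M gaussN N) \<longleftrightarrow>
        p \<in> (Pi\<^sub>E ({..<N} \<times> {..<N}) (\<lambda>p. A (Inl p))) \<times> (Pi\<^sub>E {..<N} (\<lambda>i. A (Inr i)))"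
        unfolding sp vimage_eq Int_iff mem_Times_iff PiE_iff by blast
    qed
    have "emeasure (distr (disorderN N \<Otimes>\<^sub>M gaussN N) (PiM (glass_index N) (\<lambda>_. stdG)) (glass_disorder N)) (Pi\<^sub>E (glass_index N) A)
        = emeasure (disorderN N \<Otimes>\<^sub>M gaussN N) ((Pi\<^sub>E ({..<N} \<times> {..<N}) (\<lambda>p. A (Inl p))) \<times> (Pi\<^sub>E {..<N} (\<lambda>i. A (Inr i))))"
      unfolding pre[symmetric] using A by (intro emeasure_distr m sets_PiM_I_finite) (auto simp: glass_index_def)
    also have "\<dots> = emeasure (disorderN N) (Pi\<^sub>E ({..<N} \<times> {..<N}) (\<lambda>p. A (Inl p))) * emeasure (gaussN N) (Pi\<^sub>E {..<N} (\<lambda>i. A (Inr i)))"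
      using AL AR unfolding disorderN_def gaussN_def
      by (intro G.emeasure_pair_measure_Times[unfolded gaussN_def] sets_PiM_I_finite) auto
    also have "\<dots> = (\<Prod>p\<in>{..<N} \<times> {..<N}. emeasure stdG (A (Inl p))) * (\<Prod>i\<in>{..<N}. emeasure stdG (A (Inr i)))"
      using AL AR unfolding disorderN_def gaussN_def
      by (simp only: ps1.emeasure_PiM ps2.emeasure_PiM finite_lessThan finite_cartesian_product)
    also have "\<dots> = (\<Prod>k\<in>glass_index N. emeasure stdG (A k))"
      unfolding glass_index_def by (subst prod.Plus) auto
    finally show "emeasure (distr (disorderN N \<Otimes>\<^sub>M gaussN N) (PiM (glass_index N) (\<lambda>_. stdG)) (glass_disorder N)) (Pi\<^sub>E (glass_index N) A)
        = (\<Prod>k\<in>glass_index N. emeasure stdG (A k))" .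
  qed simp
qed

section \<open>The sum rule\<close>

locale glass_interpolation =
  wick_interpolation "gaussN N" "glass_index N" "glass_obs N \<beta> q" "glass_field N lam" D glass_offset glass_slope \<kappa>
  for N :: nat and \<beta> q lam :: real and D :: "(nat \<Rightarrow> real) \<Rightarrow> real" and \<kappa> :: real +
  assumes beta_pos: "0 < \<beta>" and q_Dset: "q \<in> Dset \<beta> lam" and N_pos: "1 \<le> N"
begin

lemma q_nonneg: "0 \<le> q"
  using q_Dset by (simp add: Dset_def)

lemma glass_disorder_simps:
  "i < N \<Longrightarrow> j < N \<Longrightarrow> glass_disorder N p (Inl (i, j)) = fst p (i, j)"
  "i < N \<Longrightarrow> glass_disorder N p (Inr i) = snd p i"
  by (auto simp: glass_disorder_def glass_index_def)

lemma H_eq: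
  "H t x z = \<beta> * sqrt (t / (2 * real N)) * (\<Sum>i<N. \<Sum>j<N. x (Inl (i, j)) * z i * z j)
      - t * \<beta>\<^sup>2 / (4 * real N) * (sqnorm N z)\<^sup>2
      + \<beta> * sqrt (1 - t) * sqrt q * (\<Sum>i<N. x (Inr i) * z i)
      - (1 - t) * (\<beta>\<^sup>2 * q) / 2 * sqnorm N z + lam / 2 * sqnorm N z"
proof -
  have 1: "(\<Sum>k\<in>glass_index N. sqrt (glass_offset k + glass_slope k * t) * x k * glass_obs N \<beta> q k z) =
      \<beta> * sqrt (t / (2 * real N)) * (\<Sum>i<N. \<Sum>j<N. x (Inl (i, j)) * z i * z j)
      + \<beta> * sqrt (1 - t) * sqrt q * (\<Sum>i<N. x (Inr i) * z i)"
    unfolding sum_glass_index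
    by (simp add: glass_offset_def glass_slope_def glass_obs_def sum_distrib_left real_sqrt_divide mult_ac)
  have "H t x z = (\<Sum>k\<in>glass_index N. sqrt (glass_offset k + glass_slope k * t) * x k * glass_obs N \<beta> q k z)
      - (\<Sum>k\<in>glass_index N. (glass_offset k + glass_slope k * t) * (glass_obs N \<beta> q k z)\<^sup>2) / 2 + lam / 2 * sqnorm N z"
    unfolding H_def s_def glass_field_def by (simp add: sum_subtractf sum_divide_distrib)
  then show ?thesis
    unfolding 1 glass_obs_square_sum[OF q_nonneg] by (simp add: field_simps)
qed

lemma H_glass_disorder: "H t (glass_disorder N p) z = Hint N \<beta> lam q t (fst p) (snd p) z"
proof -
  have "(\<Sum>i<N. \<Sum>j<N. glass_disorder N p (Inl (i, j)) * z i * z j) = quadJ N (fst p) z"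
    unfolding quadJ_def by (intro sum.cong refl) (simp add: glass_disorder_simps)
  moreover have "(\<Sum>i<N. glass_disorder N p (Inr i) * z i) = (\<Sum>i<N. snd p i * z i)"
    by (intro sum.cong refl) (simp add: glass_disorder_simps)
  ultimately show ?thesis unfolding H_eq Hint_def Let_def by simp
qed

lemma Z_glass_disorder: "Z t (glass_disorder N p) = Zint N \<beta> lam q t (fst p) (snd p)"
  by (simp add: Z_def Zint_def H_glass_disorder)

section \<open>Transfer of the disorder integral and endpoint values of the free energy\<close>

lemma integral_P:
  fixes f :: "_ \<Rightarrow> real"
  assumes "f \<in> borel_measurable P"
  shows "(\<integral>x. f x \<partial>P) = (\<integral>p. f (glass_disorder N p) \<partial>(disorderN N \<Otimes>\<^sub>M gaussN N))"
  using integral_distr[OF distr_glass_disorder(1), of f N] assms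
  by (simp add: distr_glass_disorder(2) P_def)

lemma ZN_meas: "(\<lambda>J. ln (ZN N \<beta> lam J)) \<in> borel_measurable (disorderN N)"
  unfolding ZN_def HN_def quadJ_def sqnorm_def by measurable

lemma \<phi>_1: "\<phi> 1 = real N * AN N \<beta> lam"
proof -
  have "\<phi> 1 = (\<integral>p. ln (Z 1 (glass_disorder N p)) \<partial>(disorderN N \<Otimes>\<^sub>M gaussN N))"
    unfolding \<phi>_def by (rule integral_P) measurable
  also have "\<dots> = (\<integral>p. ln (ZN N \<beta> lam (fst p)) \<partial>(disorderN N \<Otimes>\<^sub>M gaussN N))"
  proof -
    have "Hint N \<beta> lam q 1 J J' z = HN N \<beta> lam J z" for J J' z
      by (simp add: Hint_def HN_def real_sqrt_divide)
    then show ?thesis by (simp add: Z_glass_disorder Zint_def ZN_def)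
  qed
  \<comment> \<open>At t = 1 the fields J' have dropped out, and since their law is a probability
    measure only the marginal of J remains.\<close>
  also have "\<dots> = (\<integral>J. ln (ZN N \<beta> lam J) \<partial>distr (disorderN N \<Otimes>\<^sub>M gaussN N) (disorderN N) fst)"
    by (rule integral_distr[symmetric]) (use ZN_meas in auto)
  also have "distr (disorderN N \<Otimes>\<^sub>M gaussN N) (disorderN N) fst = disorderN N"
    by (rule distr_pair_fst)
  finally show ?thesis using N_pos by (simp add: AN_def)
qed

text \<open>At t = 0 the weight is a product over sites of Gaussians with precision v, each computed
  by \<open>integral_stdG_exp_quadratic\<close>; the remaining disorder average uses only that x_i^2
  has mean 1.\<close>

lemma \<phi>_0:
  assumes v_def: "v = 1 - lam + \<beta>\<^sup>2 * q"
  shows "\<phi> 0 = real N * (\<beta>\<^sup>2 * q / (2 * v) - ln v / 2)"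
proof -
  have v: "0 < v" using q_Dset by (simp add: v_def Dset_def)
  interpret ps: product_sigma_finite "\<lambda>_::nat. stdG" by (rule product_sigma_finite_stdG)
  interpret PP: prob_space P by (rule prob_space_P)
  have Z0: "ln (Z 0 x) = (\<Sum>i<N. \<beta>\<^sup>2 * q / (2 * v) * (x (Inr i))\<^sup>2 - ln v / 2)" for x
  proof -
    have "exp (H 0 x z) = (\<Prod>i<N. exp (\<beta> * sqrt q * x (Inr i) * z i - (v - 1) / 2 * (z i)\<^sup>2))" for z
    proof -
      have "H 0 x z = (\<Sum>i<N. \<beta> * sqrt q * x (Inr i) * z i - (v - 1) / 2 * (z i)\<^sup>2)"
      proof -
        have "(\<Sum>i<N. \<beta> * sqrt q * x (Inr i) * z i - (v - 1) / 2 * (z i)\<^sup>2)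
            = \<beta> * sqrt q * (\<Sum>i<N. x (Inr i) * z i) - (v - 1) / 2 * sqnorm N z"
          unfolding sum_subtractf sqnorm_def sum_distrib_left by (simp add: mult.assoc)
        then show ?thesis unfolding H_eq v_def by (simp add: field_simps)
      qed
      then show ?thesis by (simp add: exp_sum)
    qed
    then have "Z 0 x = (\<integral>z. (\<Prod>i<N. exp (\<beta> * sqrt q * x (Inr i) * z i - (v - 1) / 2 * (z i)\<^sup>2)) \<partial>gaussN N)"
      by (simp only: Z_def)
    also have "\<dots> = (\<Prod>i<N. \<integral>y. exp (\<beta> * sqrt q * x (Inr i) * y - (v - 1) / 2 * y\<^sup>2) \<partial>stdG)"
      unfolding gaussN_def
      by (intro ps.product_integral_prod integrable_stdG_exp_quadratic[OF v] finite_lessThan)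
    also have "\<dots> = (\<Prod>i<N. exp ((\<beta> * sqrt q * x (Inr i))\<^sup>2 / (2 * v)) / sqrt v)"
      by (simp only: integral_stdG_exp_quadratic[OF v])
    also have "\<dots> = (\<Prod>i<N. exp (\<beta>\<^sup>2 * q / (2 * v) * (x (Inr i))\<^sup>2 - ln v / 2))"
    proof (rule prod.cong[OF refl])
      fix i
      have "sqrt v = exp (ln v / 2)"
        using v by (simp add: ln_sqrt[symmetric])
      then show "exp ((\<beta> * sqrt q * x (Inr i))\<^sup>2 / (2 * v)) / sqrt v = exp (\<beta>\<^sup>2 * q / (2 * v) * (x (Inr i))\<^sup>2 - ln v / 2)"
        using q_nonneg by (simp add: exp_diff power_mult_distrib)
    qed
    finally show ?thesis by (simp add: exp_sum[symmetric])
  qed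
  have sq: "integrable P (\<lambda>x. (x (Inr i))\<^sup>2)" "(\<integral>x. (x (Inr i))\<^sup>2 \<partial>P) = 1" if "i < N" for i
    unfolding P_def using that integrable_stdG_square integral_stdG_square
      integrable_PiM_stdG_component[of "\<lambda>x. x\<^sup>2" "Inr i" "glass_index N"]
      integral_PiM_stdG_component[of "\<lambda>x. x\<^sup>2" "Inr i" "glass_index N"]
    by (auto simp: glass_index_def)
  have "\<phi> 0 = (\<Sum>i<N. \<integral>x. \<beta>\<^sup>2 * q / (2 * v) * (x (Inr i))\<^sup>2 - ln v / 2 \<partial>P)"
    unfolding \<phi>_def Z0 using sq by (intro Bochner_Integration.integral_sum) auto
  also have "\<dots> = (\<Sum>i<N. \<beta>\<^sup>2 * q / (2 * v) - ln v / 2)"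
  proof (rule sum.cong[OF refl])
    fix i assume "i \<in> {..<N}"
    then have "i < N" by simp
    then show "(\<integral>x. \<beta>\<^sup>2 * q / (2 * v) * (x (Inr i))\<^sup>2 - ln v / 2 \<partial>P) = \<beta>\<^sup>2 * q / (2 * v) - ln v / 2"
      using sq[OF \<open>i < N\<close>] by (subst Bochner_Integration.integral_diff) (auto simp: PP.prob_space)
  qed
  finally show ?thesis by simp
qed

text \<open>Couplings contribute N beta^2 q_12^2 / 2 and fields, with slope -1, contribute -N beta^2
  q q_12. The factor 2 / (N beta^2) normalises these to q_12^2 - 2 q q_12, and q^2 completes the
  square.\<close>

lemma overlap_deviation:
  "(overlap N z1 z2 - q)\<^sup>2 = q\<^sup>2 + 2 / (real N * \<beta>\<^sup>2) * (\<Sum>k\<in>glass_index N. glass_slope k * (glass_obs N \<beta> q k z1 * glass_obs N \<beta> q k z2))"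
proof -
  define R where "R = (\<Sum>i<N. z1 i * z2 i)"
  have "R * R = (\<Sum>i<N. \<Sum>j<N. (z1 i * z2 i) * (z1 j * z2 j))"
    unfolding R_def by (rule sum_product)
  moreover have "(\<Sum>k\<in>glass_index N. glass_slope k * (glass_obs N \<beta> q k z1 * glass_obs N \<beta> q k z2))
     = (\<Sum>i<N. \<Sum>j<N. \<beta>\<^sup>2 / (2 * real N) * ((z1 i * z2 i) * (z1 j * z2 j))) - (\<Sum>i<N. \<beta>\<^sup>2 * q * (z1 i * z2 i))"
  proof -
    have "glass_slope (Inl (i,j)) * (glass_obs N \<beta> q (Inl (i,j)) z1 * glass_obs N \<beta> q (Inl (i,j)) z2)
        = \<beta>\<^sup>2 / (2 * real N) * ((z1 i * z2 i) * (z1 j * z2 j))" for i j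
      by (simp add: glass_slope_def glass_obs_def power2_eq_square)
    moreover have "glass_slope (Inr i) * (glass_obs N \<beta> q (Inr i) z1 * glass_obs N \<beta> q (Inr i) z2)
        = - (\<beta>\<^sup>2 * q * (z1 i * z2 i))" for i
    proof -
      have "glass_slope (Inr i) * (glass_obs N \<beta> q (Inr i) z1 * glass_obs N \<beta> q (Inr i) z2)
        = - (\<beta>\<^sup>2 * (sqrt q * sqrt q) * (z1 i * z2 i))"
        by (simp add: glass_slope_def glass_obs_def power2_eq_square del: real_sqrt_mult_self)
      then show ?thesis using q_nonneg by simp
    qed
    ultimately show ?thesis unfolding sum_glass_index by (simp add: sum_negf)
  qed
  ultimately have sum: "(\<Sum>k\<in>glass_index N. glass_slope k * (glass_obs N \<beta> q k z1 * glass_obs N \<beta> q k z2))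
     = \<beta>\<^sup>2 / (2 * real N) * (R * R) - \<beta>\<^sup>2 * q * R"
    by (simp add: R_def sum_distrib_left)
  have ov: "overlap N z1 z2 = R / real N" by (simp add: overlap_def R_def)
  show ?thesis unfolding sum ov using beta_pos N_pos
    by (simp add: field_simps power2_eq_square)
qed

lemma bracket_eq:
  assumes t: "0 < t" "t < 1"
  shows "bracket N \<beta> lam q t (\<lambda>z1 z2. (overlap N z1 z2 - q)\<^sup>2) =
    q\<^sup>2 + 2 / (real N * \<beta>\<^sup>2) * (\<Sum>k\<in>glass_index N. glass_slope k * (\<integral>x. (avg t x (glass_obs N \<beta> q k))\<^sup>2 \<partial>P))"
proof -
  interpret PP: prob_space P by (rule prob_space_P)
  let ?f = "\<lambda>x. q\<^sup>2 + 2 / (real N * \<beta>\<^sup>2) * (\<Sum>k\<in>glass_index N. glass_slope k * (avg t x (glass_obs N \<beta> q k))\<^sup>2)"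
  have "omega2 N \<beta> lam q t (fst p) (snd p) (\<lambda>z1 z2. (overlap N z1 z2 - q)\<^sup>2) = ?f (glass_disorder N p)" for p
    unfolding omega2_def overlap_deviation H_glass_disorder[symmetric] Z_glass_disorder[symmetric]
    by (rule two_replica_average[OF t])
  then have "bracket N \<beta> lam q t (\<lambda>z1 z2. (overlap N z1 z2 - q)\<^sup>2) = (\<integral>x. ?f x \<partial>P)"
    unfolding bracket_def by (subst integral_P) (auto intro!: borel_measurable_add borel_measurable_times borel_measurable_sum borel_measurable_power)
  also have "\<dots> = q\<^sup>2 + 2 / (real N * \<beta>\<^sup>2) * (\<Sum>k\<in>glass_index N. glass_slope k * (\<integral>x. (avg t x (glass_obs N \<beta> q k))\<^sup>2 \<partial>P))"
    using stein_avg_g(3)[OF t] by (simp add: PP.prob_space)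
  finally show ?thesis .
qed

text \<open>All integrands are nonnegative, and a Bochner integral that fails to exist is 0, so this
  holds for every t.\<close>

lemma bracket_nonneg: "0 \<le> bracket N \<beta> lam q t (\<lambda>z1 z2. (overlap N z1 z2 - q)\<^sup>2)"
  unfolding bracket_def omega2_def
  by (intro Bochner_Integration.integral_nonneg divide_nonneg_nonneg mult_nonneg_nonneg) auto

text \<open>Inside the interval the bracket is q^2 - 4 / (N beta^2) times the derivative of
  \<open>\<phi>\<close>. The work lies in passing from the gauge integral of
  \<open>has_integral_\<phi>\<close> to the Lebesgue integral of the claim.\<close>

lemma interval_integral_bracket:
  "(LBINT t=0..1. bracket N \<beta> lam q t (\<lambda>z1 z2. (overlap N z1 z2 - q)\<^sup>2)) = q\<^sup>2 - 4 / (real N * \<beta>\<^sup>2) * (\<phi> 1 - \<phi> 0)"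
  "0 \<le> (LBINT t=0..1. bracket N \<beta> lam q t (\<lambda>z1 z2. (overlap N z1 z2 - q)\<^sup>2))"
proof -
  define B where "B t = q\<^sup>2 + 2 / (real N * \<beta>\<^sup>2) * (\<Sum>k\<in>glass_index N. glass_slope k * (\<integral>x. (avg t x (glass_obs N \<beta> q k))\<^sup>2 \<partial>P))" for t
  have B: "bracket N \<beta> lam q t (\<lambda>z1 z2. (overlap N z1 z2 - q)\<^sup>2) = B t" if "0 < t" "t < 1" for t
    unfolding B_def by (rule bracket_eq[OF that])
  have Bn: "0 \<le> B t" if "0 < t" "t < 1" for t
    using bracket_nonneg[of t] B[OF that] by simp
  have Bm: "B \<in> borel_measurable borel" unfolding B_def[abs_def]
    by (intro borel_measurable_add borel_measurable_times borel_measurable_sum borel_measurable_const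
        measurable_integral_avg_square g_meas)
  have "((\<lambda>t. q\<^sup>2 - 4 / (real N * \<beta>\<^sup>2) * (- (1/2) * (\<Sum>k\<in>glass_index N. glass_slope k * (\<integral>x. (avg t x (glass_obs N \<beta> q k))\<^sup>2 \<partial>P))))
      has_integral (q\<^sup>2 - 4 / (real N * \<beta>\<^sup>2) * (\<phi> 1 - \<phi> 0))) {0..1}"
    by (rule has_integral_diff[OF _ has_integral_mult_right[OF has_integral_\<phi>]])
      (use has_integral_const_real[of "q\<^sup>2" 0 1] in simp)
  moreover have "(\<lambda>t. q\<^sup>2 - 4 / (real N * \<beta>\<^sup>2) * (- (1/2) * (\<Sum>k\<in>glass_index N. glass_slope k * (\<integral>x. (avg t x (glass_obs N \<beta> q k))\<^sup>2 \<partial>P)))) = B"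
    by (simp add: B_def fun_eq_iff)
  ultimately have hi: "(B has_integral (q\<^sup>2 - 4 / (real N * \<beta>\<^sup>2) * (\<phi> 1 - \<phi> 0))) {0<..<1}"
    by (simp add: has_integral_Icc_iff_Ioo)
  \<comment> \<open>Nonnegativity upgrades gauge integrability to absolute integrability.\<close>
  then have "B absolutely_integrable_on {0<..<1}"
    by (intro nonnegative_absolutely_integrable_1) (use Bn in auto)
  \<comment> \<open>Absolute integrability refers to the completed Lebesgue measure; Borel
    measurability of \<open>B\<close> is what brings it down to \<open>lborel\<close>.\<close>
  then have "set_integrable lborel {0<..<1} B"
    unfolding set_integrable_def using Bm by (subst (asm) integrable_completion) auto
  from set_borel_integral_eq_integral(2)[OF this]
  have "(LINT t:{0<..<1}|lborel. B t) = q\<^sup>2 - 4 / (real N * \<beta>\<^sup>2) * (\<phi> 1 - \<phi> 0)"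
    using hi by (simp add: integral_unique)
  \<comment> \<open>\<open>B\<close> is known to agree with the bracket only for 0 < t < 1; the
    interval integral ignores the endpoints.\<close>
  moreover have "(LBINT t=0..1. bracket N \<beta> lam q t (\<lambda>z1 z2. (overlap N z1 z2 - q)\<^sup>2)) = (LINT t:{0<..<1}|lborel. B t)"
    using B by (subst interval_integral_Ioo) (auto intro!: set_lebesgue_integral_cong)
  ultimately show "(LBINT t=0..1. bracket N \<beta> lam q t (\<lambda>z1 z2. (overlap N z1 z2 - q)\<^sup>2)) = q\<^sup>2 - 4 / (real N * \<beta>\<^sup>2) * (\<phi> 1 - \<phi> 0)"
    by simp
  moreover have "0 \<le> q\<^sup>2 - 4 / (real N * \<beta>\<^sup>2) * (\<phi> 1 - \<phi> 0)"
    by (rule has_integral_nonneg[OF hi]) (use Bn in auto)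
  ultimately show "0 \<le> (LBINT t=0..1. bracket N \<beta> lam q t (\<lambda>z1 z2. (overlap N z1 z2 - q)\<^sup>2))"
    by simp
qed

end

theorem mainTheorem8:
  fixes \<beta> lam qbar :: real and N :: nat
  assumes "\<beta> > 0" and "qbar \<in> Dset \<beta> lam" and "N \<ge> 1"
  shows "AN N \<beta> lam = Atilde \<beta> lam qbar
           - \<beta>^2 / 4 * (LBINT t=0..1.
                bracket N \<beta> lam qbar t (\<lambda>z1 z2. (overlap N z1 z2 - qbar)^2))
         \<and> AN N \<beta> lam \<le> Atilde \<beta> lam qbar"
proof -
  obtain \<kappa> D where "wick_interpolation (gaussN N) (glass_index N) (glass_obs N \<beta> qbar) (glass_field N lam) D glass_offset glass_slope \<kappa>"
    using wick_interpolation_glass[OF assms] by blast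
  then interpret glass_interpolation N \<beta> qbar lam D \<kappa>
    using assms by (simp add: glass_interpolation_def glass_interpolation_axioms_def)
  define I where "I = (LBINT t=0..1. bracket N \<beta> lam qbar t (\<lambda>z1 z2. (overlap N z1 z2 - qbar)\<^sup>2))"
  define v where "v = 1 - lam + \<beta>\<^sup>2 * qbar"
  have v: "0 < v" using assms(2) by (simp add: v_def Dset_def)
  have I: "I = qbar\<^sup>2 - 4 / (real N * \<beta>\<^sup>2) * (real N * AN N \<beta> lam - real N * (\<beta>\<^sup>2 * qbar / (2 * v) - ln v / 2))"
    unfolding I_def interval_integral_bracket(1) \<phi>_1 \<phi>_0[OF v_def] ..
  have "\<beta>\<^sup>2 / 4 * I = \<beta>\<^sup>2 / 4 * qbar\<^sup>2 - (AN N \<beta> lam - (\<beta>\<^sup>2 * qbar / (2 * v) - ln v / 2))"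
    unfolding I right_diff_distrib using assms(1,3) by (simp add: field_simps)
  \<comment> \<open>With sigma^2 = 1 / v and ln sigma = - ln v / 2, the expression in parentheses is
    \<open>\<phi>\<close> 0 divided by N.\<close>
  moreover have "Atilde \<beta> lam qbar = (\<beta>\<^sup>2 * qbar / (2 * v) - ln v / 2) + \<beta>\<^sup>2 / 4 * qbar\<^sup>2"
    unfolding Atilde_def v_def[symmetric] Let_def using v
    by (simp add: ln_div ln_sqrt power_divide)
  ultimately have eq: "AN N \<beta> lam = Atilde \<beta> lam qbar - \<beta>\<^sup>2 / 4 * I" by linarith
  moreover have "0 \<le> \<beta>\<^sup>2 / 4 * I" using interval_integral_bracket(2) by (simp add: I_def)
  ultimately show ?thesis unfolding I_def by linarith
qed

end
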